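(* Let $\theta\in(0,1)$ be irrational and let $q_k$ ($k\ge 0$) be the denominators of the principal convergents $p_k/q_k$ of its continued fraction expansion, with $q_0=1$. Let $\varphi$ be a monotone increasing positive function on the positive integers. Then $$\liminf_{n\to\infty} n\,\varphi(n)\,\| n\theta - s\| = 0 \quad\text{for Lebesgue-almost every } s\in\mathbb{R}$$ if and only if $$\sum_{k=0}^\infty \frac{\log\left(\min\left(\varphi(q_k),\, q_{k+1}/q_k\right)\right)}{\varphi(q_k)} = \infty .$$
   Context: For $t\in\mathbb{R}$, $\|t\|$ denotes the distance from $t$ to the nearest integer. For an irrational $\theta\in(0,1)$ with continued fraction partial quotients $a_1,a_2,\dots$, the convergent denominators are defined by $q_0=1$, $q_1=a_1$, $q_{k+1}=a_{k+1}q_k+q_{k-1}$.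
   Formalization: The formal theorem also assumes φ(n) > 1 for some n ≥ 1; if φ ≤ 1 everywhere (e.g. φ = 1), all summands are ≤ 0, so the sum is not ∞, while the liminf is 0 for almost every s, so the printed equivalence fails. *)

theory Defs
  imports "HOL-Analysis.Analysis"
begin

definition dist_int :: "real \<Rightarrow> real" where
  "dist_int t = \<bar>t - of_int (round t)\<bar>"

definition gauss_map :: "real \<Rightarrow> real" where
  "gauss_map x = frac (1 / x)"

(* For irrational \<theta> in (0,1) we have \<theta> = [0; a_1, a_2, ...], where
   a_k is the integer part of 1 / T^(k-1)(\<theta>) and T is the Gauss map.
   Only indices k \<ge> 1 are meaningful: a_0 = 0 is the integer part of \<theta> and is
   not given by this formula. *)
definition partial_quotient :: "real \<Rightarrow> nat \<Rightarrow> nat" where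
  "partial_quotient \<theta> k = nat \<lfloor>1 / (gauss_map ^^ (k - 1)) \<theta>\<rfloor>"

fun conv_denom :: "real \<Rightarrow> nat \<Rightarrow> nat" where
  "conv_denom \<theta> 0 = 1"
| "conv_denom \<theta> (Suc 0) = partial_quotient \<theta> 1"
| "conv_denom \<theta> (Suc (Suc k)) =
     partial_quotient \<theta> (Suc (Suc k)) * conv_denom \<theta> (Suc k) + conv_denom \<theta> k"

end

theory Submission
  imports Defs
begin

text \<open>
  Put \<open>F k = \<phi> (q k)\<close> and count the indices \<open>n\<close> in blocks between \<open>q k\<close> and \<open>q (k + 1)\<close>. Modulo 1,
  the points \<open>n * \<theta>\<close> of one block form \<open>q k\<close> arithmetic progressions with step \<open>q k * \<theta> - p k\<close>, of
  size about \<open>1 / q (k + 1)\<close>, one in each interval \<open>[i / q k, (i + 1) / q k)\<close>. So the arcs of radius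
  \<open>1 / (n * \<phi> n)\<close> around them overlap for \<open>n < q (k + 1) / F k\<close> and are essentially disjoint
  afterwards, and the measure of their union is comparable to the \<open>k\<close>-th term of the series, up to
  replacing \<open>F k\<close> by \<open>F (k + 1)\<close> in lower bounds; the change is summable.

  If the series converges, Borel--Cantelli applies. If it diverges, so does its restriction to some
  residue class of \<open>k\<close> modulo a large \<open>L\<close>. Along this class, the arcs of the earlier blocks have far fewer than
  \<open>q k\<close> endpoints, so the new arcs, equidistributed at scale \<open>1 / q k\<close>, fill a proportional
  part of the complement of the earlier ones. As \<open>L\<close> is arbitrary, this complement shrinks to a
  null set.
\<close>

section \<open>Distance to the nearest integer\<close>

lemma dist_int_nonneg: "0 \<le> dist_int t"
  by (simp add: dist_int_def)

lemma dist_int_le: "dist_int t \<le> \<bar>t - of_int m\<bar>"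
  unfolding dist_int_def by (rule round_diff_minimal)

lemma dist_int_less_iff: "dist_int t < r \<longleftrightarrow> (\<exists>z::int. \<bar>t - of_int z\<bar> < r)"
  by (metis dist_int_def dist_int_le le_less_trans)

lemma dist_int_eq_0_iff: "dist_int t = 0 \<longleftrightarrow> t \<in> \<int>"
  by (metis Ints_of_int abs_le_zero_iff abs_zero cancel_comm_monoid_add_class.diff_cancel
      diff_zero dist_int_def eq_iff_diff_eq_0 round_of_int Ints_cases abs_eq_0_iff)

lemma dist_int_add_of_int: "dist_int (t + of_int m) = dist_int t"
proof (rule antisym)
  show "dist_int (t + of_int m) \<le> dist_int t"
    using dist_int_le[of "t + of_int m" "round t + m"] by (simp add: dist_int_def)
  show "dist_int t \<le> dist_int (t + of_int m)"
    using dist_int_le[of t "round (t + of_int m) - m"] by (simp add: dist_int_def algebra_simps)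
qed

lemma dist_int_lipschitz: "\<bar>dist_int s - dist_int t\<bar> \<le> \<bar>s - t\<bar>"
  using dist_int_le[of s "round t"] dist_int_le[of t "round s"] unfolding dist_int_def by linarith

lemma continuous_on_dist_int [continuous_intros]:
  assumes "continuous_on S f" shows "continuous_on S (\<lambda>x. dist_int (f x))"
proof -
  have "continuous_on UNIV dist_int"
    unfolding continuous_on_iff dist_real_def using dist_int_lipschitz le_less_trans by blast
  from continuous_on_compose2[OF this assms] show ?thesis by simp
qed

text \<open>By connectedness, a tile that meets an arc without lying inside it contains an endpoint
  of the arc. This allows partially covered tiles to be counted by endpoints.\<close>

lemma dist_int_crosses_level:
  assumes "dist_int (x - s) < r" "r \<le> dist_int (x - t)" "s \<in> {u..<v}" "t \<in> {u..<v}"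
  obtains y where "y \<in> {u..<v}" "dist_int (x - y) = r"
proof -
  have "connected ((\<lambda>y. dist_int (x - y)) ` {u..<v})"
    by (intro connected_continuous_image continuous_intros) auto
  then have "r \<in> (\<lambda>y. dist_int (x - y)) ` {u..<v}"
    using assms unfolding connected_iff_interval
    by (elim ballE[of _ _ "dist_int (x - s)"] ballE[of _ _ "dist_int (x - t)"]) auto
  then show ?thesis using that by auto
qed

section \<open>Convergents\<close>

text \<open>The numerators of the convergents; the initial values 0 and 1 reflect that the integer
  part of \<open>\<theta>\<close> is 0.\<close>

fun conv_num :: "real \<Rightarrow> nat \<Rightarrow> int" where
  "conv_num \<theta> 0 = 0"
| "conv_num \<theta> (Suc 0) = 1"
| "conv_num \<theta> (Suc (Suc k)) =
     int (partial_quotient \<theta> (Suc (Suc k))) * conv_num \<theta> (Suc k) + conv_num \<theta> k"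

locale irrational_unit =
  fixes \<theta> :: real
  assumes theta_pos: "0 < \<theta>" and theta_less_1: "\<theta> < 1" and theta_irrational: "\<theta> \<notin> \<rat>"
begin

abbreviation "tail k \<equiv> (gauss_map ^^ k) \<theta>"
abbreviation "a k \<equiv> partial_quotient \<theta> k"
abbreviation "q k \<equiv> conv_denom \<theta> k"

definition "err k = real (q k) * \<theta> - of_int (conv_num \<theta> k)"

text \<open>Irrationality survives inversion and removal of the integer part, and it excludes the
  value 0, so the expansion never terminates.\<close>

lemma tail_bounds: "tail k \<notin> \<rat> \<and> 0 < tail k \<and> tail k < 1"
proof (induction k)
  case 0
  then show ?case using theta_pos theta_less_1 theta_irrational by simp
next
  case (Suc k)
  then have "1 / tail k \<notin> \<rat>"
    by (metis Rats_inverse inverse_eq_divide inverse_inverse_eq)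
  then have "frac (1 / tail k) \<notin> \<rat>"
    by (metis Rats_add Rats_of_int add.commute diff_add_cancel frac_def)
  moreover from this have "frac (1 / tail k) \<noteq> 0"
    by (metis Rats_0)
  ultimately show ?case
    using frac_ge_0[of "1 / tail k"] frac_lt_1[of "1 / tail k"]
    unfolding funpow.simps(2) o_apply gauss_map_def[of "tail k"] by linarith
qed

lemma tail_unfold: "1 / tail k = real (a (Suc k)) + tail (Suc k)"
proof -
  have "\<lfloor>1 / tail k\<rfloor> \<ge> 0"
    using tail_bounds[of k] by simp
  then show ?thesis
    by (simp add: partial_quotient_def gauss_map_def frac_def)
qed

lemma partial_quotient_ge_1: "a (Suc k) \<ge> 1"
proof -
  have "1 / tail k > 1" using tail_bounds[of k] by simp
  then have "real (a (Suc k)) > 0" using tail_unfold[of k] tail_bounds[of "Suc k"] by linarith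
  then show ?thesis by simp
qed

lemma q_pos: "q k \<ge> 1"
proof (cases k)
  case (Suc l)
  have "q (Suc l) \<ge> 1 \<and> q l \<ge> 1" for l
    using partial_quotient_ge_1 by (induction l) (auto simp: Suc_le_eq)
  then show ?thesis using Suc by blast
qed simp

lemma q_Suc_bounds: "a (Suc k) * q k \<le> q (Suc k)" "q (Suc k) \<le> (a (Suc k) + 1) * q k"
  and q_mono_Suc: "q k \<le> q (Suc k)"
proof -
  have "a (Suc k) * q k \<le> q (Suc k) \<and> q (Suc k) \<le> (a (Suc k) + 1) * q k \<and> q k \<le> q (Suc k)"
  proof (induction k)
    case 0
    then show ?case using partial_quotient_ge_1[of 0] by simp
  next
    case (Suc k)
    have "q (Suc k) \<le> a (Suc (Suc k)) * q (Suc k)"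
      using partial_quotient_ge_1[of "Suc k"] by simp
    then have "q (Suc k) \<le> q (Suc (Suc k))"
      unfolding conv_denom.simps(3) by (rule trans_le_add1)
    then show ?case using Suc by simp
  qed
  then show "a (Suc k) * q k \<le> q (Suc k)" "q (Suc k) \<le> (a (Suc k) + 1) * q k" "q k \<le> q (Suc k)"
    by blast+
qed

lemma q_double: "2 * q k \<le> q (Suc (Suc k))"
proof -
  have "q (Suc k) \<le> a (Suc (Suc k)) * q (Suc k)"
    using partial_quotient_ge_1[of "Suc k"] by simp
  then show ?thesis using q_mono_Suc[of k] unfolding conv_denom.simps(3) by linarith
qed

text \<open>Numerators and denominators obey the same recurrence, hence so does \<open>err\<close>;
  comparison with \<open>tail_unfold\<close> gives the ratio. In particular the signs
  alternate.\<close>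

lemma err_Suc: "err (Suc k) = - tail (Suc k) * err k"
proof (induction k)
  case 0
  have "1 = (real (a (Suc 0)) + tail (Suc 0)) * \<theta>"
    using tail_unfold[of 0] theta_pos by (simp add: field_simps)
  then show ?case by (simp add: err_def algebra_simps)
next
  case (Suc k)
  have "1 = (real (a (Suc (Suc k))) + tail (Suc (Suc k))) * tail (Suc k)"
    using tail_unfold[of "Suc k"] tail_bounds[of "Suc k"] by (metis less_irrefl nonzero_eq_divide_eq)
  then have "err k = (real (a (Suc (Suc k))) + tail (Suc (Suc k))) * (tail (Suc k) * err k)"
    by (metis mult.assoc mult_1)
  also have "tail (Suc k) * err k = - err (Suc k)" using Suc by simp
  finally have "err k = - (real (a (Suc (Suc k))) + tail (Suc (Suc k))) * err (Suc k)"
    by (simp only: mult_minus_left mult_minus_right)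
  moreover have "err (Suc (Suc k)) = real (a (Suc (Suc k))) * err (Suc k) + err k"
    by (simp add: err_def algebra_simps)
  ultimately show ?case by (simp add: algebra_simps)
qed

text \<open>Passing from \<open>k\<close> to \<open>Suc k\<close> multiplies the first factor by
  \<open>tail (Suc k)\<close> and divides the second by it, so the product is invariant.\<close>

lemma abs_err: "\<bar>err k\<bar> * (real (q (Suc k)) + tail (Suc k) * real (q k)) = 1"
proof (induction k)
  case 0
  have "1 = (real (a (Suc 0)) + tail (Suc 0)) * \<theta>"
    using tail_unfold[of 0] theta_pos by (simp add: field_simps)
  then show ?case using theta_pos by (simp add: err_def algebra_simps)
next
  case (Suc k)
  let ?x = "tail (Suc k)" and ?y = "tail (Suc (Suc k))" and ?a = "real (a (Suc (Suc k)))"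
  have 1: "1 = (?a + ?y) * ?x"
    using tail_unfold[of "Suc k"] tail_bounds[of "Suc k"] by (metis less_irrefl nonzero_eq_divide_eq)
  have 2: "\<bar>err (Suc k)\<bar> = ?x * \<bar>err k\<bar>"
    unfolding err_Suc using tail_bounds[of "Suc k"] by (simp add: abs_mult)
  have "\<bar>err (Suc k)\<bar> * (real (q (Suc (Suc k))) + ?y * real (q (Suc k)))
      = \<bar>err k\<bar> * (((?a + ?y) * ?x) * real (q (Suc k)) + ?x * real (q k))"
    unfolding 2 by (simp add: algebra_simps)
  also have "\<dots> = 1" unfolding 1[symmetric] using Suc by simp
  finally show ?case .
qed

lemma err_upper: "\<bar>err k\<bar> * real (q (Suc k)) \<le> 1"
proof -
  have "0 \<le> \<bar>err k\<bar> * (tail (Suc k) * real (q k))"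
    using tail_bounds[of "Suc k"] by simp
  then show ?thesis using abs_err[of k] by (simp add: algebra_simps)
qed

lemma err_lower: "1 \<le> \<bar>err k\<bar> * (2 * real (q (Suc k)))"
proof -
  have "tail (Suc k) * real (q k) \<le> 1 * real (q (Suc k))"
    using tail_bounds[of "Suc k"] q_mono_Suc[of k] by (intro mult_mono) auto
  then have "\<bar>err k\<bar> * (real (q (Suc k)) + tail (Suc k) * real (q k)) \<le> \<bar>err k\<bar> * (2 * real (q (Suc k)))"
    by (intro mult_left_mono) auto
  then show ?thesis using abs_err[of k] by simp
qed

text \<open>Consecutive convergents have determinant 1 or -1, so a common divisor divides 1.\<close>

lemma coprime_conv: "coprime (conv_num \<theta> k) (int (q k))"
proof -
  have "\<bar>conv_num \<theta> (Suc k) * int (q k) - conv_num \<theta> k * int (q (Suc k))\<bar> = 1"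
    by (induction k) (auto simp: algebra_simps)
  moreover have "c dvd 1" if "c dvd conv_num \<theta> k" "c dvd int (q k)" 
    and "\<bar>conv_num \<theta> (Suc k) * int (q k) - conv_num \<theta> k * int (q (Suc k))\<bar> = 1" for c
    using that by (metis dvd_abs_iff dvd_diff dvd_mult dvd_mult2)
  ultimately show ?thesis by (auto intro: coprimeI)
qed

end

section \<open>Estimates for series\<close>

text \<open>The sum dominates the integral of \<open>1 / (x * F + a)\<close> over
  \<open>[1, a + 1]\<close>, which is \<open>1 / F\<close> times the logarithm of
  \<open>((a + 1) * F + a) / (F + a)\<close>. That quotient is at least the square root of the
  minimum. Up to scaling, the summands bound from below the arc lengths inside one tile.\<close>

lemma ln_min_le_sum:
  fixes F :: real and a :: nat
  assumes "1 \<le> F"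
  shows "ln (min F (real a + 1)) / (2 * F) \<le> (\<Sum>j<a. 1 / (real (Suc j) * F + real a))"
proof -
  define M where "M = min F (real a + 1)"
  define f where "f j = ln (real (Suc j) * F + real a)" for j
  have arg_pos: "0 < real (Suc j) * F + real a" for j
    using assms by (intro add_pos_nonneg mult_pos_pos) auto
  have M: "1 \<le> M" "M \<le> F" "M \<le> real a + 1" using assms by (auto simp: M_def)
  \<comment> \<open>Each summand uses a different one of the two upper bounds for
    \<open>M\<close>.\<close>
  have "M * F + M * real a \<le> (real a + 1) * F + F * real a"
    using M assms by (intro add_mono mult_right_mono) auto
  then have "(M + 1) / 2 * (F + real a) \<le> real (Suc a) * F + real a"
    by (simp add: field_simps)
  moreover have "sqrt M \<le> (M + 1) / 2"
    using arith_geo_mean_sqrt[of M 1] M by simp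
  moreover have "0 < F + real a" using assms by simp
  ultimately have "sqrt M * (F + real a) \<le> real (Suc a) * F + real a"
    by (meson less_imp_le mult_right_mono order_trans)
  then have "ln (sqrt M * (F + real a)) \<le> f a"
    unfolding f_def using M \<open>0 < F + real a\<close> by (intro ln_mono) auto
  then have "ln M / 2 \<le> f a - f 0"
    using M \<open>0 < F + real a\<close> by (simp add: ln_mult ln_sqrt f_def)
  also have "f a - f 0 = (\<Sum>j<a. f (Suc j) - f j)"
    by (rule sum_lessThan_telescope[symmetric])
  also have "\<dots> \<le> (\<Sum>j<a. F * (1 / (real (Suc j) * F + real a)))"
  proof (rule sum_mono)
    fix j
    let ?u = "real (Suc j) * F + real a"
    have "f (Suc j) - f j = ln ((?u + F) / ?u)"
      using arg_pos[of j] arg_pos[of "Suc j"] by (simp add: f_def ln_div algebra_simps)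
    also have "\<dots> = ln (1 + F / ?u)" using arg_pos[of j] by (simp add: add_divide_distrib)
    also have "\<dots> \<le> F / ?u" using arg_pos[of j] assms by (intro ln_add_one_self_le_self) simp
    finally show "f (Suc j) - f j \<le> F * (1 / ?u)" by simp
  qed
  finally have "ln M / 2 \<le> F * (\<Sum>j<a. 1 / (real (Suc j) * F + real a))"
    by (simp add: sum_distrib_left)
  then show ?thesis using assms by (simp add: M_def field_simps)
qed

text \<open>Since \<open>1 / n \<le> 2 / (n + 1) \<le> 2 * ln ((n + 1) / n)\<close>, the logarithms
  telescope. The factor 2 absorbs the shift from \<open>n + 1\<close> to \<open>n\<close>.\<close>

lemma sum_inverse_le_ln:
  fixes m n :: nat
  assumes "1 \<le> m" "m \<le> n"
  shows "(\<Sum>i\<in>{m..<n}. 1 / real i) \<le> 2 * ln (real n / real m)"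
  using assms(2)
proof (induction n rule: dec_induct)
  case base
  then show ?case using assms by simp
next
  case (step n)
  have n: "1 \<le> real n" using step assms by simp
  have "ln (real n / real (Suc n)) \<le> real n / real (Suc n) - 1"
    using n by (intro ln_le_minus_one) auto
  also have "\<dots> = - (1 / (real n + 1))" using n by (simp add: field_simps)
  also have "\<dots> \<le> - (1 / (2 * real n))" using n by (simp add: field_simps)
  finally have "1 / real n \<le> 2 * ln (real (Suc n)) - 2 * ln (real n)"
    using n by (simp add: ln_div)
  then show ?case using step assms n by (simp add: ln_div)
qed

text \<open>The correction \<open>h k * (1 / F k - 1 / F (k + 1))\<close> is summable because
  \<open>- (1 + ln x) / x\<close> is an antiderivative of \<open>ln x / x\<^sup>2\<close> and stays bounded.\<close>

lemma not_summable_shift_denominator: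
  fixes F h :: "nat \<Rightarrow> real"
  assumes F: "\<And>k. 1 \<le> F k" "\<And>k. F k \<le> F (Suc k)"
    and h: "\<And>k. 0 \<le> h k" "\<And>k. h k \<le> ln (F k)"
    and div: "\<not> summable (\<lambda>k. h k / F k)"
  shows "\<not> summable (\<lambda>k. h k / F (Suc k))"
proof
  assume sum: "summable (\<lambda>k. h k / F (Suc k))"
  define H where "H k = (1 + ln (F k)) / F k" for k
  define d where "d k = h k * (1 / F k - 1 / F (Suc k))" for k
  have Fpos: "0 < F k" for k using F(1)[of k] by linarith
  have diff: "0 \<le> 1 / F k - 1 / F (Suc k)" for k
    using F(2)[of k] Fpos[of k] by (simp add: frac_le)
  have d_le: "d k \<le> H k - H (Suc k)" for k
  proof -
    \<comment> \<open>This inequality replaces the differentiation of \<open>H\<close> in the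
      discrete setting.\<close>
    have "ln (F (Suc k) / F k) \<le> F (Suc k) / F k - 1"
      using Fpos[of k] Fpos[of "Suc k"] by (intro ln_le_minus_one) auto
    then have "(ln (F (Suc k)) - ln (F k)) / F (Suc k) \<le> (F (Suc k) / F k - 1) / F (Suc k)"
      using Fpos[of k] Fpos[of "Suc k"] by (intro divide_right_mono) (auto simp: ln_div)
    also have "\<dots> = 1 / F k - 1 / F (Suc k)"
      using Fpos[of k] Fpos[of "Suc k"] by (simp add: field_simps)
    finally have "ln (F k) * (1 / F k - 1 / F (Suc k)) \<le> H k - H (Suc k)"
      unfolding H_def by (simp add: algebra_simps add_divide_distrib diff_divide_distrib)
    moreover have "d k \<le> ln (F k) * (1 / F k - 1 / F (Suc k))"
      unfolding d_def using h(2) diff by (rule mult_right_mono)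
    ultimately show ?thesis by linarith
  qed
  have "summable d"
  proof (rule summableI_nonneg_bounded)
    show "0 \<le> d n" for n unfolding d_def using h diff by simp
    show "(\<Sum>i<n. d i) \<le> H 0" for n
    proof -
      have "(\<Sum>i<n. d i) \<le> (\<Sum>i<n. H i - H (Suc i))" by (intro sum_mono d_le)
      also have "\<dots> = H 0 - H n" by (rule sum_lessThan_telescope')
      also have "\<dots> \<le> H 0" unfolding H_def using F(1)[of n] by simp
      finally show ?thesis .
    qed
  qed
  from summable_add[OF sum this] have "summable (\<lambda>k. h k / F k)"
    by (simp add: d_def algebra_simps)
  with div show False by blast
qed

text \<open>Grouping the first \<open>n * L\<close> terms by residue bounds all partial sums.
  Summability can thus be tested along one sparse progression of indices at a time.\<close>

lemma summable_by_residues: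
  fixes t :: "nat \<Rightarrow> real"
  assumes "0 < L" "\<And>k. 0 \<le> t k" "\<And>r. r < L \<Longrightarrow> summable (\<lambda>i. t (i * L + r))"
  shows "summable t"
proof (rule summableI_nonneg_bounded)
  fix n
  have "(\<Sum>k<n. t k) \<le> (\<Sum>k<n * L. t k)"
    using assms by (intro sum_mono2) auto
  also have "\<dots> = (\<Sum>i<n. \<Sum>k\<in>{i * L..<i * L + L}. t k)"
    by (rule sum.nat_group[symmetric])
  also have "\<dots> = (\<Sum>i<n. \<Sum>r<L. t (i * L + r))"
  proof (rule sum.cong[OF refl])
    fix i
    show "(\<Sum>k\<in>{i * L..<i * L + L}. t k) = (\<Sum>r<L. t (i * L + r))"
      using sum.shift_bounds_nat_ivl[of t 0 "i * L" L] by (simp add: add.commute lessThan_atLeast0)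
  qed
  also have "\<dots> = (\<Sum>r<L. \<Sum>i<n. t (i * L + r))" by (rule sum.swap)
  also have "\<dots> \<le> (\<Sum>r<L. \<Sum>i. t (i * L + r))"
    using assms by (intro sum_mono sum_le_suminf) auto
  finally show "(\<Sum>k<n. t k) \<le> (\<Sum>r<L. \<Sum>i. t (i * L + r))" .
qed (use assms in auto)

text \<open>Nonnegativity is asked only from \<open>k0\<close> on because \<open>\<phi>\<close> may
  start below 1, which makes the first logarithms negative.\<close>

lemma filterlim_sum_at_top_iff_not_summable:
  fixes t :: "nat \<Rightarrow> real"
  assumes "\<And>k. k0 \<le> k \<Longrightarrow> 0 \<le> t k"
  shows "filterlim (\<lambda>n. \<Sum>k<n. t k) at_top sequentially \<longleftrightarrow> \<not> summable t"
proof
  assume lim: "filterlim (\<lambda>n. \<Sum>k<n. t k) at_top sequentially"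
  show "\<not> summable t"
  proof
    assume "summable t"
    then have "(\<lambda>n. \<Sum>k<n. t k) \<longlonglongrightarrow> suminf t" by (rule summable_LIMSEQ)
    moreover have "filterlim (\<lambda>n. \<Sum>k<n. t k) at_infinity sequentially"
      using lim filterlim_at_top_imp_at_infinity by blast
    ultimately show False using not_tendsto_and_filterlim_at_infinity sequentially_bot by blast
  qed
next
  assume not_summable: "\<not> summable t"
  have mono: "(\<Sum>k<m. t k) \<le> (\<Sum>k<n. t k)" if "k0 \<le> m" "m \<le> n" for m n
    using that assms by (intro sum_mono2) auto
  show "filterlim (\<lambda>n. \<Sum>k<n. t k) at_top sequentially"
    unfolding filterlim_at_top
  proof (rule ccontr)
    assume "\<not> (\<forall>Z. \<forall>\<^sub>F n in sequentially. Z \<le> (\<Sum>k<n. t k))"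
    then obtain Z where Z: "\<And>m. \<exists>n\<ge>m. (\<Sum>k<n. t k) < Z"
      unfolding eventually_sequentially by (meson not_le)
    have bound: "(\<Sum>k<m. t k) \<le> Z" if "k0 \<le> m" for m
      using Z[of m] mono[OF that] by (meson less_imp_le order_trans)
    have "summable (\<lambda>k. t (k + k0))"
    proof (rule summableI_nonneg_bounded)
      show "(\<Sum>k<n. t (k + k0)) \<le> Z - (\<Sum>k<k0. t k)" for n
      proof -
        have "(\<Sum>k<n + k0. t k) = (\<Sum>k<k0. t k) + (\<Sum>k<n. t (k + k0))"
          by (induction n) auto
        then show ?thesis using bound[of "n + k0"] by simp
      qed
    qed (use assms in auto)
    with not_summable show False by (simp add: summable_iff_shift)
  qed
qed

section \<open>Unions of arcs and equally spaced tiles\<close>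

text \<open>The two candidates are the ends of the arc around \<open>x\<close>, reduced modulo 1; an
  arc therefore has at most two endpoints in the unit interval.\<close>

lemma dist_int_eqD:
  assumes "dist_int (x - y) = r" "0 \<le> y" "y < 1"
  shows "y = frac (x - r) \<or> y = frac (x + r)"
proof -
  define z where "z = round (x - y)"
  have "x - y - of_int z = r \<or> x - y - of_int z = - r"
    using assms(1) unfolding dist_int_def z_def by linarith
  then have "y + of_int z = x - r \<or> y + of_int z = x + r" by linarith
  moreover have "frac (y + of_int z) = y"
    using assms by (simp add: frac_eq)
  ultimately show ?thesis by metis
qed

text \<open>The elements of \<open>P\<close> are pairs of a centre and a radius of an arc modulo 1.\<close>

definition near :: "(real \<times> real) set \<Rightarrow> real set" where
  "near P = {s. \<exists>(x, r)\<in>P. dist_int (x - s) < r}"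

lemma near_Union: "near (\<Union>i\<in>I. P i) = (\<Union>i\<in>I. near (P i))"
  by (auto simp: near_def)

lemma near_Un: "near (P \<union> Q) = near P \<union> near Q"
  by (auto simp: near_def)

lemma open_near: "open (near P)"
proof -
  have "near P = (\<Union>p\<in>P. {s. dist_int (fst p - s) < snd p})"
    by (auto simp: near_def)
  also have "open \<dots>" by (intro open_UN ballI open_Collect_less continuous_intros)
  finally show ?thesis .
qed

lemma near_measurable [measurable]: "near P \<in> sets borel"
  using open_near by (rule borel_open)

section \<open>Equal tiles and the gain from new arcs\<close>

abbreviation tile :: "nat \<Rightarrow> nat \<Rightarrow> real set" where
  "tile N i \<equiv> {real i / real N..<(real i + 1) / real N}"

lemma tile_bounds:
  assumes "s \<in> tile N i" "i < N" shows "0 \<le> s" "s < 1"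
proof -
  have "real i / real N \<le> s" using assms by simp
  moreover have "0 \<le> real i / real N" by simp
  ultimately show "0 \<le> s" by linarith
  have "real i + 1 \<le> real N" using assms by linarith
  then have "(real i + 1) / real N \<le> 1" using assms by (simp add: divide_le_eq)
  moreover have "s < (real i + 1) / real N" using assms by simp
  ultimately show "s < 1" by linarith
qed

lemma mem_tile_iff:
  assumes "0 < N" "0 \<le> s" shows "s \<in> tile N i \<longleftrightarrow> i = nat \<lfloor>real N * s\<rfloor>"
proof -
  have "s \<in> tile N i \<longleftrightarrow> real_of_int (int i) \<le> real N * s \<and> real N * s < real_of_int (int i) + 1"
    using assms by (simp add: divide_le_eq less_divide_eq mult.commute)
  also have "\<dots> \<longleftrightarrow> \<lfloor>real N * s\<rfloor> = int i" by (simp only: floor_eq_iff)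
  also have "\<dots> \<longleftrightarrow> i = nat \<lfloor>real N * s\<rfloor>"
  proof -
    have "0 \<le> \<lfloor>real N * s\<rfloor>" using assms by simp
    then show ?thesis by linarith
  qed
  finally show ?thesis .
qed

lemma fmeasurable_Ico: "{u..<v::real} \<in> fmeasurable lborel"
  by (cases "u \<le> v") (auto simp: fmeasurable_def)

text \<open>A tile is disjoint from the arcs, covered by them, or contains an endpoint of one of
  them. The last kind occurs at most \<open>2 * card P\<close> times, and tiles of the first and
  last kind together cover the complement.\<close>

lemma card_tiles_disjoint_near:
  assumes "finite P" "0 < N"
  shows "real N * measure lborel ({0..<1} - near P) - 2 * real (card P)
    \<le> real (card {i\<in>{..<N}. tile N i \<inter> near P = {}})"
proof -
  define good where "good = {i\<in>{..<N}. tile N i \<inter> near P = {}}"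
  define bad where "bad = {i\<in>{..<N}. tile N i \<inter> near P \<noteq> {} \<and> \<not> tile N i \<subseteq> near P}"
  define E where "E = (\<lambda>(x, r). frac (x - r)) ` P \<union> (\<lambda>(x, r). frac (x + r)) ` P"
  have fin: "finite good" "finite bad" "finite E" using assms by (auto simp: good_def bad_def E_def)
  have "card E \<le> card P + card P"
    unfolding E_def by (intro order_trans[OF card_Un_le] add_mono card_image_le assms)
  \<comment> \<open>Each endpoint lies in only one tile, so the tile index maps \<open>E\<close>
    onto a set containing \<open>bad\<close>.\<close>
  moreover have "bad \<subseteq> (\<lambda>y. nat \<lfloor>real N * y\<rfloor>) ` E"
  proof
    fix i assume "i \<in> bad"
    then obtain s t x r where i: "i < N" and st: "s \<in> tile N i" "t \<in> tile N i" "t \<notin> near P"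
      and xr: "(x, r) \<in> P" "dist_int (x - s) < r"
      unfolding bad_def near_def by blast
    then have "r \<le> dist_int (x - t)" unfolding near_def by force
    with xr st obtain y where y: "y \<in> tile N i" "dist_int (x - y) = r"
      using dist_int_crosses_level by metis
    have "0 \<le> y" "y < 1" using tile_bounds[OF y(1) i] by auto
    then have "y \<in> E" using dist_int_eqD[OF y(2)] xr(1) unfolding E_def by force
    moreover have "i = nat \<lfloor>real N * y\<rfloor>" using mem_tile_iff[OF assms(2) \<open>0 \<le> y\<close>] y(1) by blast
    ultimately show "i \<in> (\<lambda>y. nat \<lfloor>real N * y\<rfloor>) ` E" by blast
  qed
  then have "card bad \<le> card E" using fin by (meson card_image_le card_mono finite_imageI order_trans)
  ultimately have bad: "card bad \<le> 2 * card P" by linarith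
  have "{0..<1} - near P \<subseteq> (\<Union>i\<in>good \<union> bad. tile N i)"
  proof
    fix s assume s: "s \<in> {0..<1} - near P"
    define i where "i = nat \<lfloor>real N * s\<rfloor>"
    have si: "s \<in> tile N i" using mem_tile_iff[OF assms(2), of s i] s i_def by simp
    have "real N * s < real N" using s assms by simp
    then have "i < N" unfolding i_def using s by (simp add: nat_less_iff floor_less_iff)
    then have "i \<in> good \<union> bad" using si s by (auto simp: good_def bad_def)
    then show "s \<in> (\<Union>i\<in>good \<union> bad. tile N i)" using si by blast
  qed
  then have "measure lborel ({0..<1} - near P) \<le> measure lborel (\<Union>i\<in>good \<union> bad. tile N i)"
    using fin by (intro measure_mono_fmeasurable fmeasurable.finite_UN fmeasurable_Ico) auto
  also have "\<dots> \<le> (\<Sum>i\<in>good \<union> bad. measure lborel (tile N i))"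
    using fin by (intro measure_UNION_le) auto
  also have "\<dots> = (\<Sum>i\<in>good \<union> bad. 1 / real N)"
    using assms by (intro sum.cong) (auto simp: divide_right_mono diff_divide_distrib[symmetric])
  also have "\<dots> \<le> (real (card good) + 2 * real (card P)) * (1 / real N)"
    using card_Un_le[of good bad] bad unfolding sum_constant
    by (intro mult_right_mono) auto
  finally have "measure lborel ({0..<1} - near P) \<le> (real (card good) + 2 * real (card P)) / real N"
    by simp
  then show ?thesis using assms unfolding good_def[symmetric]
    by (simp add: pos_le_divide_eq mult.commute)
qed

text \<open>On each tile free of old arcs, the new arcs contribute at least \<open>m\<close>; these
  contributions are disjoint from one another and from the old arcs.\<close>

lemma measure_near_Un_ge:
  assumes "finite P" "0 < N" and tile: "\<And>i. i < N \<Longrightarrow> m \<le> measure lborel (near Q \<inter> tile N i)"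
  shows "measure lborel (near P \<inter> {0..<1})
      + real (card {i\<in>{..<N}. tile N i \<inter> near P = {}}) * m
    \<le> measure lborel (near (P \<union> Q) \<inter> {0..<1})"
proof -
  define good where "good = {i\<in>{..<N}. tile N i \<inter> near P = {}}"
  define A where "A i = near Q \<inter> tile N i" for i
  have fin: "finite good" by (simp add: good_def)
  have fm: "A i \<in> fmeasurable lborel" "near R \<inter> {0..<1} \<in> fmeasurable lborel" for i R
    unfolding A_def by (simp_all add: Int_commute[of "near _"] fmeasurable_Int_fmeasurable fmeasurable_Ico)
  have "disjoint_family_on A good"
  proof (unfold disjoint_family_on_def, safe)
    fix i j s assume "i \<in> good" "j \<in> good" "i \<noteq> j" "s \<in> A i" "s \<in> A j"
    then have "s \<in> tile N i" "s \<in> tile N j" "i < N"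
      by (auto simp: A_def good_def)
    moreover from this have "0 \<le> s" using tile_bounds(1) by blast
    ultimately show "s \<in> {}" using mem_tile_iff[OF assms(2)] \<open>i \<noteq> j\<close> by metis
  qed
  then have "measure lborel (\<Union>i\<in>good. A i) = (\<Sum>i\<in>good. measure lborel (A i))"
    using fin fm by (intro measure_finite_Union) (auto simp: fmeasurable_def less_top[symmetric])
  also have "\<dots> \<ge> (\<Sum>i\<in>good. m)"
    using tile by (intro sum_mono) (auto simp: A_def good_def)
  finally have "real (card good) * m \<le> measure lborel (\<Union>i\<in>good. A i)" by simp
  moreover have UA: "(\<Union>i\<in>good. A i) \<in> fmeasurable lborel"
    using fin fm by (intro fmeasurable.finite_UN)
  have "measure lborel ((near P \<inter> {0..<1}) \<union> (\<Union>i\<in>good. A i))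
      = measure lborel (near P \<inter> {0..<1}) + measure lborel (\<Union>i\<in>good. A i)"
    using fm UA by (intro measure_Union) (auto simp: fmeasurable_def A_def good_def less_top[symmetric])
  moreover have "(near P \<inter> {0..<1}) \<union> (\<Union>i\<in>good. A i) \<subseteq> near (P \<union> Q) \<inter> {0..<1}"
  proof -
    have "tile N i \<subseteq> {0..<1}" if "i < N" for i
      using tile_bounds that by (meson atLeastLessThan_iff subsetI)
    then show ?thesis unfolding A_def good_def near_Un by fast
  qed
  then have "measure lborel ((near P \<inter> {0..<1}) \<union> (\<Union>i\<in>good. A i))
      \<le> measure lborel (near (P \<union> Q) \<inter> {0..<1})"
    using fm UA by (intro measure_mono_fmeasurable) (auto simp: fmeasurable_def)
  ultimately show ?thesis unfolding good_def[symmetric] by linarith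
qed

text \<open>Along an arithmetic progression of indices with large difference \<open>L\<close>, the arcs of all earlier
  stages have few endpoints compared with \<open>q k\<close>. A tile without such endpoints is either covered by
  the earlier stages or disjoint from them, so stage \<open>k\<close> adds measure at least \<open>\<beta> / 2 * t k\<close> if
  a set of measure \<open>\<beta>\<close> is never covered.\<close>

lemma null_complement_near_Union:
  fixes q :: "nat \<Rightarrow> nat" and S :: "nat \<Rightarrow> (real \<times> real) set" and t :: "nat \<Rightarrow> real"
  assumes q_pos: "\<And>k. 1 \<le> q k" and q_mono: "\<And>k. q k \<le> q (Suc k)"
    and q_double: "\<And>k. 2 * q k \<le> q (Suc (Suc k))"
    and finite_S: "\<And>k. finite (S k)" and card_S: "\<And>k. card (S k) \<le> q (Suc k)"
    and tile: "\<And>k i. i < q k \<Longrightarrow> t k / real (q k) \<le> measure lborel (near (S k) \<inter> tile (q k) i)"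
    and t_nonneg: "\<And>k. 0 \<le> t k" and diverges: "\<not> summable t"
  shows "{0..<1} - near (\<Union>k. S k) \<in> null_sets lborel"
proof (rule ccontr)
  define \<beta> where "\<beta> = measure lborel ({0..<1} - near (\<Union>k. S k))"
  have fm: "{0..<1} - near R \<in> fmeasurable lborel" "near R \<inter> {0..<1} \<in> fmeasurable lborel" for R
    by (simp_all add: Int_commute[of "near _"] fmeasurable_Int_fmeasurable fmeasurable_Diff fmeasurable_Ico)
  assume "{0..<1} - near (\<Union>k. S k) \<notin> null_sets lborel"
  then have "\<beta> \<noteq> 0"
    using fm(1) emeasure_eq_measure2[OF fm(1)] unfolding \<beta>_def
    by (auto simp: null_sets_def fmeasurable_def)
  then have "0 < \<beta>"
    unfolding \<beta>_def by (simp add: order_less_le)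
  \<comment> \<open>With \<open>2 ^ l * card (P i) \<le> 2 * q k\<close>, shown below, the constant
    8 makes \<open>2 * card (P i)\<close> at most half of \<open>q k * \<beta>\<close>.\<close>
  obtain l :: nat where "8 / \<beta> < 2 ^ l" using real_arch_pow[of 2 "8 / \<beta>"] by auto
  then have l: "8 \<le> \<beta> * 2 ^ l" using \<open>0 < \<beta>\<close> by (simp add: field_simps)
  \<comment> \<open>Two indices per doubling give the factor \<open>2 ^ l\<close>; the extra two
    give one more doubling, or pay for starting from \<open>q (Suc k)\<close>.\<close>
  define L where "L = 2 * l + 2"
  have q_pow: "2 ^ n * q k \<le> q (k + 2 * n)" for k n
  proof (induction n)
    case (Suc n)
    then show ?case using q_double[of "k + 2 * n"] by simp
  qed simp
  have "summable (\<lambda>i. t (i * L + r))" for r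
  proof (rule summableI_nonneg_bounded)
    define P where "P i = (\<Union>j<i. S (j * L + r))" for i
    have finP: "finite (P i)" for i unfolding P_def using finite_S by blast
    have P_Suc: "P (Suc i) = P i \<union> S (i * L + r)" for i
      unfolding P_def by (auto simp: less_Suc_eq)
    \<comment> \<open>In the induction, the old arcs and the newly added ones each contribute at
      most \<open>q\<close> at the next index of the progression.\<close>
    have cardP: "2 ^ l * card (P i) \<le> 2 * q (i * L + r)" for i
    proof (induction i)
      case (Suc i)
      have "card (P (Suc i)) \<le> card (P i) + q (Suc (i * L + r))"
        unfolding P_Suc using card_Un_le card_S by (meson add_left_mono order_trans)
      then have "2 ^ l * card (P (Suc i)) \<le> 2 ^ l * card (P i) + 2 ^ l * q (Suc (i * L + r))"
        by (metis add_mult_distrib2 mult_le_mono2)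
      also have "2 ^ l * q (Suc (i * L + r)) \<le> q (Suc i * L + r)"
        using order_trans[OF q_pow[of l "Suc (i * L + r)"] q_mono[of "Suc (i * L + r) + 2 * l"]]
        by (simp add: L_def algebra_simps)
      also have "2 ^ l * card (P i) \<le> 2 * q (i * L + r)" by (rule Suc.IH)
      also have "\<dots> \<le> 2 ^ Suc l * q (i * L + r)" by simp
      also have "\<dots> \<le> q (Suc i * L + r)"
        using q_pow[of "Suc l" "i * L + r"] by (simp add: L_def algebra_simps)
      finally show ?case by simp
    qed (simp add: P_def)
    \<comment> \<open>At least \<open>\<beta> / 2 * q k\<close> tiles are free of earlier arcs, and
      each gains \<open>t k / q k\<close>.\<close>
    have gain: "measure lborel (near (P i) \<inter> {0..<1}) + \<beta> / 2 * t (i * L + r)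
        \<le> measure lborel (near (P (Suc i)) \<inter> {0..<1})" for i
    proof -
      define k where "k = i * L + r"
      have "\<beta> \<le> measure lborel ({0..<1} - near (P i))"
        unfolding \<beta>_def
      proof (intro measure_mono_fmeasurable fm fmeasurableD)
        show "{0..<1} - near (\<Union>k. S k) \<subseteq> {0..<1} - near (P i)"
          unfolding P_def near_Union by blast
      qed
      then have "real (q k) * \<beta> \<le> real (q k) * measure lborel ({0..<1} - near (P i))"
        by (intro mult_left_mono) auto
      also have "\<dots> \<le> real (card {j\<in>{..<q k}. tile (q k) j \<inter> near (P i) = {}}) + 2 * real (card (P i))"
        using card_tiles_disjoint_near[OF finP, of "q k" i] q_pos[of k] by simp
      also have "2 * real (card (P i)) \<le> real (q k) * \<beta> / 2"
      proof -
        have "real (2 ^ l * card (P i)) \<le> real (2 * q k)"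
          using cardP[of i] unfolding k_def of_nat_le_iff .
        then have "\<beta> * (2 ^ l * real (card (P i))) \<le> \<beta> * (2 * real (q k))"
          using \<open>0 < \<beta>\<close> by (intro mult_left_mono) auto
        moreover have "8 * real (card (P i)) \<le> \<beta> * 2 ^ l * real (card (P i))"
          using l by (intro mult_right_mono) auto
        ultimately show ?thesis by (simp add: algebra_simps)
      qed
      finally have "\<beta> / 2 * real (q k) \<le> real (card {j\<in>{..<q k}. tile (q k) j \<inter> near (P i) = {}})"
        by (simp add: algebra_simps)
      then have "\<beta> / 2 * real (q k) * (t k / real (q k))
          \<le> real (card {j\<in>{..<q k}. tile (q k) j \<inter> near (P i) = {}}) * (t k / real (q k))"
        using t_nonneg[of k] by (intro mult_right_mono) auto
      moreover have "\<beta> / 2 * real (q k) * (t k / real (q k)) = \<beta> / 2 * t k"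
        using q_pos[of k] by simp
      moreover have "measure lborel (near (P i) \<inter> {0..<1})
          + real (card {j\<in>{..<q k}. tile (q k) j \<inter> near (P i) = {}}) * (t k / real (q k))
        \<le> measure lborel (near (P i \<union> S k) \<inter> {0..<1})"
        using q_pos[of k] by (intro measure_near_Un_ge finP tile) auto
      ultimately show ?thesis unfolding P_Suc k_def[symmetric] by linarith
    qed
    \<comment> \<open>The gains add up to at most the length of the unit interval, which bounds the
      partial sums.\<close>
    fix n
    have "\<beta> / 2 * (\<Sum>i<n. t (i * L + r)) \<le> measure lborel (near (P n) \<inter> {0..<1})"
    proof (induction n)
      case (Suc n)
      then show ?case using gain[of n] by (simp add: distrib_left)
    qed simp
    also have "\<dots> \<le> measure lborel {0..<1::real}"
      using fm by (intro measure_mono_fmeasurable fmeasurable_Ico) (auto simp: fmeasurable_def)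
    finally show "(\<Sum>i<n. t (i * L + r)) \<le> 2 / \<beta>" using \<open>0 < \<beta>\<close> by (simp add: field_simps)
  qed (use t_nonneg in auto)
  moreover have "0 < L" by (simp add: L_def)
  ultimately have "summable t" using t_nonneg summable_by_residues by blast
  with diverges show False by blast
qed

section \<open>Upper bounds for the measure of unions of arcs\<close>

lemma sum_image_snd_le:
  fixes f :: "nat \<Rightarrow> real"
  assumes "finite I" "\<And>i. i \<in> I \<Longrightarrow> 0 \<le> f i"
  shows "(\<Sum>(x, r)\<in>(\<lambda>i. (g i, f i)) ` I. r) \<le> (\<Sum>i\<in>I. f i)"
  using sum_image_le[of I snd "\<lambda>i. (g i, f i)"] assms by (simp add: case_prod_beta o_def)

text \<open>For \<open>r \<le> 1 / 2\<close>, the parts of the interval around \<open>frac x\<close>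
  cut off at 0 and 1 reappear at the opposite ends, so the total length stays
  \<open>2 * r\<close>.\<close>

lemma measure_arc_le:
  assumes "0 \<le> r"
  shows "measure lborel (near {(x, r)} \<inter> {0..<1}) \<le> 2 * r"
proof -
  have fm: "near {(x, r)} \<inter> {0..<1} \<in> fmeasurable lborel"
    by (simp add: Int_commute[of "near _"] fmeasurable_Int_fmeasurable fmeasurable_Ico)
  show ?thesis
  proof (cases "r \<le> 1 / 2")
    case False
    have "measure lborel (near {(x, r)} \<inter> {0..<1}) \<le> measure lborel {0..<1::real}"
      using fm by (intro measure_mono_fmeasurable fmeasurable_Ico) (auto simp: fmeasurable_def)
    then show ?thesis using False by simp
  next
    case True
    define y where "y = frac x"
    have y: "0 \<le> y" "y < 1" by (auto simp: y_def frac_lt_1)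
    \<comment> \<open>The three pieces belong to the nearest integers 0, 1 and -1 of
      \<open>y - s\<close>; the last two are the wrapped ends and may be empty.\<close>
    define I :: "nat \<Rightarrow> real set" where
      "I i = (if i = 0 then {max 0 (y - r)..min 1 (y + r)} else if i = 1 then {0..y - 1 + r} else {y + 1 - r..1})" for i
    have Icc: "measure lborel {u..v::real} \<le> max 0 (v - u)" for u v
      by (cases "u \<le> v") auto
    have "near {(x, r)} \<inter> {0..<1} \<subseteq> (\<Union>i<3. I i)"
    proof
      fix s assume "s \<in> near {(x, r)} \<inter> {0..<1}"
      then have s: "dist_int (x - s) < r" "0 \<le> s" "s < 1" by (auto simp: near_def)
      have "dist_int (y - s) = dist_int (x - s)"
        using dist_int_add_of_int[of "x - s" "- \<lfloor>x\<rfloor>"] by (simp add: y_def frac_def algebra_simps)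
      with s have "dist_int (y - s) < r" by simp
      then obtain z :: int where z: "\<bar>y - s - of_int z\<bar> < r" by (auto simp: dist_int_less_iff)
      then have "-2 < real_of_int z" "real_of_int z < 2" using y s True by linarith+
      then have "z = -1 \<or> z = 0 \<or> z = 1" by auto
      then have "s \<in> I 0 \<or> s \<in> I 1 \<or> s \<in> I 2"
        using z s y True unfolding I_def by auto
      then show "s \<in> (\<Union>i<3. I i)" by (auto intro: bexI[of _ 0] bexI[of _ 1] bexI[of _ 2])
    qed
    then have "measure lborel (near {(x, r)} \<inter> {0..<1}) \<le> measure lborel (\<Union>i<3. I i)"
      using fm by (intro measure_mono_fmeasurable fmeasurable.finite_UN)
        (auto simp: I_def fmeasurable_def emeasure_lborel_Icc_eq)
    also have "\<dots> \<le> (\<Sum>i<3. measure lborel (I i))" by (intro measure_UNION_le) (auto simp: I_def)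
    also have "\<dots> = measure lborel (I 0) + measure lborel (I 1) + measure lborel (I 2)"
      by (simp add: eval_nat_numeral)
    also have "\<dots> \<le> max 0 (min 1 (y + r) - max 0 (y - r)) + max 0 (y - 1 + r - 0) + max 0 (1 - (y + 1 - r))"
      unfolding I_def using Icc by (auto intro!: add_mono)
    also have "\<dots> \<le> 2 * r" using y True assms by linarith
    finally show ?thesis .
  qed
qed

lemma measure_near_le:
  assumes "finite P" "\<And>x r. (x, r) \<in> P \<Longrightarrow> 0 \<le> r"
  shows "measure lborel (near P \<inter> {0..<1}) \<le> 2 * (\<Sum>(x, r)\<in>P. r)"
proof -
  have "near P \<inter> {0..<1} = (\<Union>p\<in>P. near {p} \<inter> {0..<1})" by (auto simp: near_def)
  also have "measure lborel \<dots> \<le> (\<Sum>p\<in>P. measure lborel (near {p} \<inter> {0..<1}))"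
    using assms by (intro measure_UNION_le) auto
  also have "\<dots> \<le> (\<Sum>p\<in>P. 2 * snd p)"
    using assms by (intro sum_mono) (auto intro!: measure_arc_le)
  finally show ?thesis by (simp add: sum_distrib_left case_prod_beta)
qed

lemma negligible_UN_countable:
  assumes "countable I" "\<And>i. i \<in> I \<Longrightarrow> negligible (A i)"
  shows "negligible (\<Union>i\<in>I. A i)"
  using assms by (simp add: negligible_iff_null_sets null_sets_UN')

section \<open>Divergence\<close>

text \<open>A Bezout coefficient \<open>u\<close> inverts \<open>p\<close> modulo \<open>N\<close>,
  so \<open>m\<close> is taken congruent to \<open>i * u\<close>.\<close>

lemma exists_mult_mod_eq:
  fixes p :: int and N :: nat
  assumes "coprime p (int N)" "0 < N"
  obtains m :: nat and z :: int where "1 \<le> m" "m \<le> N" "int m * p = i + z * int N"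
proof -
  obtain u v where uv: "u * p + v * int N = 1" using bezout_int[of p "int N"] assms by auto
  \<comment> \<open>Subtracting 1 before reduction and adding it back afterwards places
    \<open>m\<close> in \<open>{1..N}\<close>, avoiding the index 0.\<close>
  define m0 where "m0 = (i * u - 1) mod int N"
  define m where "m = nat (m0 + 1)"
  have m0: "0 \<le> m0" "m0 < int N" using assms by (auto simp: m0_def)
  have "int m = i * u - int N * ((i * u - 1) div int N)"
    using m0 minus_div_mult_eq_mod[of "i * u - 1" "int N"] unfolding m_def m0_def by (simp add: algebra_simps)
  then have "int m * p = (i * u - int N * ((i * u - 1) div int N)) * p" by simp
  also have "\<dots> = i * (u * p) - int N * ((i * u - 1) div int N) * p"
    by (simp add: algebra_simps)
  also have "u * p = 1 - v * int N" using uv by simp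
  finally have "int m * p = i + (- i * v - ((i * u - 1) div int N) * p) * int N"
    by (simp add: algebra_simps)
  moreover have "1 \<le> m" "m \<le> N" using m0 by (auto simp: m_def)
  ultimately show ?thesis using that by blast
qed

context irrational_unit
begin

text \<open>Modulo 1, the multiples \<open>n * \<theta>\<close> with \<open>n\<close> in a residue class modulo \<open>q k\<close> form an arithmetic
  progression with step \<open>err k\<close> that starts next to a multiple of \<open>1 / q k\<close>, on its right or left
  according to the sign of \<open>err k\<close>.\<close>

definition cell_start :: "nat \<Rightarrow> nat \<Rightarrow> nat \<Rightarrow> real" where
  "cell_start k i j = (if 0 < err k then real i / real (q k) + real j * err k
     else (real i + 1) / real (q k) + real (Suc j) * err k)"

abbreviation "cell k i j \<equiv> {cell_start k i j..<cell_start k i j + \<bar>err k\<bar>}"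

lemma err_nonzero: "err k \<noteq> 0"
  using err_lower[of k] by auto

text \<open>Choosing \<open>m\<close> with \<open>m * p\<close> congruent to \<open>c\<close> modulo
  \<open>q k\<close> puts \<open>m * \<theta>\<close> at \<open>c / q k + (m / q k) * err k\<close>
  modulo 1, at most one step from the chosen end of the tile. Adding \<open>j * q k\<close> to the
  index moves it \<open>j\<close> steps further.\<close>

lemma cell_contains_multiple:
  obtains n z where "1 \<le> n" "n \<le> Suc j * q k"
    "cell_start k i j \<le> real n * \<theta> - of_int z" "real n * \<theta> - of_int z \<le> cell_start k i j + \<bar>err k\<bar>"
proof -
  define c where "c = (if 0 < err k then int i else int i + 1)"
  obtain m z where m: "1 \<le> m" "m \<le> q k" and mz: "int m * conv_num \<theta> k = c + z * int (q k)"
    using exists_mult_mod_eq[OF coprime_conv] q_pos[of k] by (metis less_eq_Suc_le One_nat_def)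
  define n where "n = j * q k + m"
  have qpos: "0 < real (q k)" using q_pos[of k] by simp
  have th: "\<theta> = (of_int (conv_num \<theta> k) + err k) / real (q k)"
    using qpos by (simp add: err_def)
  have "real m * of_int (conv_num \<theta> k) = of_int c + of_int z * real (q k)"
    using arg_cong[OF mz, of real_of_int] by simp
  then have eq: "real n * \<theta> - of_int (int j * conv_num \<theta> k + z)
      = of_int c / real (q k) + real j * err k + (real m / real (q k)) * err k"
    unfolding n_def using qpos by (subst th) (simp add: field_simps)
  have frac: "0 \<le> real m / real (q k)" "real m / real (q k) \<le> 1" using m qpos by auto
  show ?thesis
  proof (rule that[of n "int j * conv_num \<theta> k + z"])
    show "1 \<le> n" "n \<le> Suc j * q k" using m by (auto simp: n_def)
    show "cell_start k i j \<le> real n * \<theta> - of_int (int j * conv_num \<theta> k + z)"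
      unfolding eq cell_start_def c_def
      using frac mult_right_mono_neg[of "real m / real (q k)" 1 "err k"]
      by (auto simp: algebra_simps add_divide_distrib)
    show "real n * \<theta> - of_int (int j * conv_num \<theta> k + z) \<le> cell_start k i j + \<bar>err k\<bar>"
      unfolding eq cell_start_def c_def
      using frac mult_right_mono[of "real m / real (q k)" 1 "err k"]
        mult_nonneg_nonpos[of "real m / real (q k)" "err k"]
      by (auto simp: algebra_simps add_divide_distrib)
  qed
qed

text \<open>The first \<open>a (Suc k)\<close> cells fit into a tile because
  \<open>a (Suc k) * q k \<le> q (Suc k)\<close> and
  \<open>\<bar>err k\<bar> \<le> 1 / q (Suc k)\<close>.\<close>

lemma cell_subset_tile:
  assumes "j < a (Suc k)"
  shows "cell k i j \<subseteq> tile (q k) i"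
proof -
  have qpos: "0 < real (q k)" using q_pos[of k] by simp
  have "real (Suc j) * real (q k) \<le> real (a (Suc k)) * real (q k)"
    using assms by (intro mult_right_mono) auto
  also have "\<dots> \<le> real (q (Suc k))" using q_Suc_bounds(1)[of k] by (metis of_nat_le_iff of_nat_mult)
  finally have "\<bar>err k\<bar> * (real (Suc j) * real (q k)) \<le> 1"
    using err_upper[of k] by (meson abs_ge_zero mult_left_mono order_trans)
  then have "real (Suc j) * \<bar>err k\<bar> \<le> 1 / real (q k)" using qpos by (simp add: field_simps)
  then show ?thesis
    using err_nonzero[of k] mult_nonneg_nonpos[of "real j" "err k"]
    by (auto simp: cell_start_def add_divide_distrib algebra_simps
        intro: order_trans[rotated] less_le_trans)
qed

lemma cells_disjoint:
  assumes "j \<noteq> j'" shows "cell k i j \<inter> cell k i j' = {}"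
proof -
  have main: "cell k i j \<inter> cell k i j' = {}" if "j < j'" for j j'
  proof -
    have "real (Suc j) * \<bar>err k\<bar> \<le> real j' * \<bar>err k\<bar>"
      using that by (intro mult_right_mono) auto
    then show ?thesis by (auto simp: cell_start_def algebra_simps)
  qed
  show ?thesis using assms main[of j j'] main[of j' j] by (cases "j < j'") auto
qed

text \<open>Strict growth is guaranteed only from index 1 on, since \<open>q 0 = q 1\<close> when
  the first partial quotient is 1; hence the case split.\<close>

lemma q_ge: "k \<le> q k"
proof (induction k)
  case (Suc k)
  show ?case
  proof (cases k)
    case 0
    then show ?thesis using q_pos[of 1] by simp
  next
    case (Suc l)
    have "1 * q (Suc l) \<le> a (Suc (Suc l)) * q (Suc l)"
      using partial_quotient_ge_1 by (rule mult_le_mono1)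
    then have "q (Suc l) + q l \<le> q (Suc k)" unfolding Suc conv_denom.simps(3) by linarith
    then show ?thesis using Suc.IH q_pos[of l] unfolding Suc by linarith
  qed
qed simp

lemma q_mono: "m \<le> n \<Longrightarrow> q m \<le> q n"
  by (rule lift_Suc_mono_le[of q, OF q_mono_Suc])

lemma obtain_block:
  assumes "1 \<le> n" obtains k where "q k \<le> n" "n < q (Suc k)"
proof -
  define k where "k = (LEAST k. n < q (Suc k))"
  have "n < q (Suc n)" using q_ge[of "Suc n"] by simp
  then have 1: "n < q (Suc k)" unfolding k_def by (rule LeastI)
  have "q k \<le> n"
  proof (cases k)
    case (Suc l)
    then have "\<not> n < q (Suc l)" using not_less_Least[of l "\<lambda>k. n < q (Suc k)"] by (simp add: k_def)
    then show ?thesis using Suc by simp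
  qed (use assms in simp)
  with 1 show ?thesis using that by blast
qed

section \<open>Stages of arcs for the lower bound\<close>

text \<open>Indices below \<open>q k\<close> are included so that every cell receives a point. Their
  radius is cut down to \<open>\<psi> (q k)\<close>, so that it tends to 0 and a fixed small index
  cannot account for infinitely many stages.\<close>

definition stage :: "(nat \<Rightarrow> real) \<Rightarrow> nat \<Rightarrow> (real \<times> real) set" where
  "stage \<psi> k = (\<lambda>n. (real n * \<theta>, \<psi> (max n (q k)))) ` {1..q (Suc k)}"

text \<open>Each of the disjoint cells of the tile has an orbit point in its closure, and the arc
  around that point fills a piece of the cell of length at least the summand.\<close>

lemma stage_mass_on_tile:
  assumes antimono: "\<And>m n. 1 \<le> m \<Longrightarrow> m \<le> n \<Longrightarrow> \<psi> n \<le> \<psi> m"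
    and nonneg: "\<And>n. 1 \<le> n \<Longrightarrow> 0 \<le> \<psi> n"
  shows "(\<Sum>j<a (Suc k). min (\<psi> (Suc j * q k)) \<bar>err k\<bar>)
    \<le> measure lborel (near (stage \<psi> k) \<inter> tile (q k) i)"
proof -
  define \<rho> where "\<rho> j = min (\<psi> (Suc j * q k)) \<bar>err k\<bar>" for j
  have "\<exists>I. I \<in> fmeasurable lborel \<and> \<rho> j \<le> measure lborel I \<and> I \<subseteq> cell k i j \<and> I \<subseteq> near (stage \<psi> k)"
    if j: "j < a (Suc k)" for j
  proof -
    obtain n z where n: "1 \<le> n" "n \<le> Suc j * q k"
      and x: "cell_start k i j \<le> real n * \<theta> - of_int z"
        "real n * \<theta> - of_int z \<le> cell_start k i j + \<bar>err k\<bar>"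
      by (rule cell_contains_multiple)
    define x where "x = real n * \<theta> - of_int z"
    \<comment> \<open>The centre lies in the closed cell and \<open>\<rho> j\<close> is at most the
      cell length, so cutting the arc to the cell leaves length at least
      \<open>\<rho> j\<close>.\<close>
    define u v where "u = max (cell_start k i j) (x - \<rho> j)"
      and "v = min (cell_start k i j + \<bar>err k\<bar>) (x + \<rho> j)"
    have "Suc 0 * 1 \<le> Suc j * q k" using q_pos[of k] by (intro mult_le_mono) auto
    then have \<rho>: "0 \<le> \<rho> j" "\<rho> j \<le> \<bar>err k\<bar>" "\<rho> j \<le> \<psi> (Suc j * q k)"
      using nonneg by (auto simp: \<rho>_def)
    then have uv: "u + \<rho> j \<le> v" using x unfolding u_def v_def x_def[symmetric] by linarith
    then have "\<rho> j \<le> measure lborel {u<..<v}" using \<rho> by simp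
    moreover have "{u<..<v} \<subseteq> cell k i j" by (auto simp: u_def v_def)
    moreover have "{u<..<v} \<subseteq> near (stage \<psi> k)"
    proof
      fix s assume "s \<in> {u<..<v}"
      then have "\<bar>real n * \<theta> - s - of_int z\<bar> < \<rho> j" by (auto simp: u_def v_def x_def)
      moreover have "\<psi> (Suc j * q k) \<le> \<psi> (max n (q k))"
        using n q_pos[of k] by (intro antimono) auto
      ultimately have "dist_int (real n * \<theta> - s) < \<psi> (max n (q k))"
        using \<rho> dist_int_le[of "real n * \<theta> - s" z] by linarith
      moreover have "n \<le> q (Suc k)"
        using n j q_Suc_bounds(1)[of k] mult_le_mono1[of "Suc j" "a (Suc k)" "q k"] by linarith
      ultimately show "s \<in> near (stage \<psi> k)" using n by (auto simp: near_def stage_def)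
    qed
    moreover have "{u<..<v} \<in> fmeasurable lborel"
      using uv \<rho> by (auto simp: fmeasurable_def)
    ultimately show ?thesis by blast
  qed
  then obtain I where I: "\<And>j. j < a (Suc k) \<Longrightarrow> I j \<in> fmeasurable lborel"
    "\<And>j. j < a (Suc k) \<Longrightarrow> \<rho> j \<le> measure lborel (I j)"
    "\<And>j. j < a (Suc k) \<Longrightarrow> I j \<subseteq> cell k i j"
    "\<And>j. j < a (Suc k) \<Longrightarrow> I j \<subseteq> near (stage \<psi> k)"
    by metis
  have "disjoint_family_on I {..<a (Suc k)}"
  proof (unfold disjoint_family_on_def, intro ballI impI)
    fix j j' assume "j \<in> {..<a (Suc k)}" "j' \<in> {..<a (Suc k)}" "j \<noteq> j'"
    then have "I j \<subseteq> cell k i j" "I j' \<subseteq> cell k i j'" "cell k i j \<inter> cell k i j' = {}"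
      using I(3) cells_disjoint by auto
    then show "I j \<inter> I j' = {}" by blast
  qed
  have "(\<Sum>j<a (Suc k). \<rho> j) \<le> (\<Sum>j<a (Suc k). measure lborel (I j))"
    using I(2) by (intro sum_mono) auto
  also have "\<dots> = measure lborel (\<Union>j<a (Suc k). I j)"
    using I(1) \<open>disjoint_family_on I {..<a (Suc k)}\<close>
    by (intro measure_finite_Union[symmetric]) (auto simp: fmeasurable_def less_top[symmetric])
  also have "\<dots> \<le> measure lborel (near (stage \<psi> k) \<inter> tile (q k) i)"
  proof (intro measure_mono_fmeasurable)
    show "(\<Union>j<a (Suc k). I j) \<subseteq> near (stage \<psi> k) \<inter> tile (q k) i"
      using I(3,4) cell_subset_tile by blast
    show "(\<Union>j<a (Suc k). I j) \<in> sets lborel"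
      using I(1) by (intro fmeasurableD fmeasurable.finite_UN) auto
    show "near (stage \<psi> k) \<inter> tile (q k) i \<in> fmeasurable lborel"
      by (simp add: Int_commute[of "near _"] fmeasurable_Int_fmeasurable fmeasurable_Ico)
  qed
  finally show ?thesis by (simp add: \<rho>_def)
qed

text \<open>Up to \<open>q (Suc k)\<close>, monotonicity bounds \<open>\<phi>\<close> by its value
  there, which is why the denominator is taken at \<open>Suc k\<close>. The summands of
  \<open>ln_min_le_sum\<close>, scaled by \<open>\<epsilon> / q k\<close>, stay below both entries
  of the minimum.\<close>

lemma stage_mass_lower_bound:
  fixes \<phi> :: "nat \<Rightarrow> real" and \<epsilon> :: real
  defines "\<psi> \<equiv> \<lambda>n. \<epsilon> / (real n * \<phi> n)"
  assumes \<phi>: "\<And>n. 1 \<le> n \<Longrightarrow> 0 < \<phi> n" "mono_on {1..} \<phi>" and \<epsilon>: "0 < \<epsilon>" "\<epsilon> \<le> 1 / 4"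
    and ge_1: "1 \<le> \<phi> (q (Suc k))"
  shows "\<epsilon> / 2 * (ln (min (\<phi> (q (Suc k))) (real (q (Suc k)) / real (q k))) / \<phi> (q (Suc k))) / real (q k)
    \<le> (\<Sum>j<a (Suc k). min (\<psi> (Suc j * q k)) \<bar>err k\<bar>)"
proof -
  define F where "F = \<phi> (q (Suc k))"
  define A where "A = real (a (Suc k))"
  have A: "1 \<le> A" using partial_quotient_ge_1[of k] by (simp add: A_def)
  have Q: "1 \<le> real (q k)" using q_pos[of k] by simp
  have Q_Suc: "real (q (Suc k)) \<le> (A + 1) * real (q k)"
    using of_nat_mono[OF q_Suc_bounds(2)[of k], where 'a = real] by (simp add: A_def algebra_simps)
  have F: "1 \<le> F" using ge_1 by (simp add: F_def)
  have "real (q (Suc k)) / real (q k) \<le> A + 1" using Q Q_Suc by (simp add: pos_divide_le_eq)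
  moreover have "1 \<le> real (q (Suc k)) / real (q k)" using q_mono_Suc[of k] Q by simp
  ultimately have "ln (min F (real (q (Suc k)) / real (q k))) \<le> ln (min F (A + 1))"
    using F by (intro ln_mono) auto
  then have "ln (min F (real (q (Suc k)) / real (q k))) / (2 * F) \<le> ln (min F (A + 1)) / (2 * F)"
    using F by (intro divide_right_mono) auto
  also have "\<dots> \<le> (\<Sum>j<a (Suc k). 1 / (real (Suc j) * F + A))"
    unfolding A_def using F by (rule ln_min_le_sum)
  finally have "\<epsilon> / real (q k) * (ln (min F (real (q (Suc k)) / real (q k))) / (2 * F))
      \<le> \<epsilon> / real (q k) * (\<Sum>j<a (Suc k). 1 / (real (Suc j) * F + A))"
    using \<epsilon> Q by (intro mult_left_mono) auto
  also have "\<dots> = (\<Sum>j<a (Suc k). \<epsilon> / real (q k) * (1 / (real (Suc j) * F + A)))"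
    by (rule sum_distrib_left)
  also have "\<dots> \<le> (\<Sum>j<a (Suc k). min (\<psi> (Suc j * q k)) \<bar>err k\<bar>)"
  proof (rule sum_mono)
    fix j assume "j \<in> {..<a (Suc k)}"
    then have "Suc j * q k \<le> a (Suc k) * q k" by (intro mult_le_mono1) auto
    then have "Suc j * q k \<le> q (Suc k)" using q_Suc_bounds(1)[of k] by (rule order_trans)
    moreover have j_ge: "1 \<le> Suc j * q k" using q_pos[of k] by (simp add: trans_le_add1)
    ultimately have F_ge: "\<phi> (Suc j * q k) \<le> F" and pos': "0 < \<phi> (Suc j * q k)"
      unfolding F_def using \<phi> q_pos[of "Suc k"] by (auto intro!: mono_onD[OF \<phi>(2)])
    have jF: "1 \<le> real (Suc j) * F" using F mult_mono[of 1 "real (Suc j)" 1 F] by simp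
    have "\<epsilon> / real (q k) * (1 / (real (Suc j) * F + A)) = \<epsilon> / (real (q k) * (real (Suc j) * F + A))"
      by simp
    also have "\<dots> \<le> \<epsilon> / (real (Suc j * q k) * \<phi> (Suc j * q k))"
    proof (rule divide_left_mono)
      have "real (Suc j * q k) * \<phi> (Suc j * q k) \<le> real (Suc j * q k) * F"
        using F_ge by (intro mult_left_mono) auto
      also have "\<dots> = real (q k) * (real (Suc j) * F)" by (simp only: of_nat_mult mult_ac)
      also have "\<dots> \<le> real (q k) * (real (Suc j) * F + A)"
        using A Q by (intro mult_left_mono) auto
      finally show "real (Suc j * q k) * \<phi> (Suc j * q k) \<le> real (q k) * (real (Suc j) * F + A)" .
      show "0 < real (q k) * (real (Suc j) * F + A) * (real (Suc j * q k) * \<phi> (Suc j * q k))"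
        using Q A jF pos' j_ge by (intro mult_pos_pos) (auto simp del: mult_Suc of_nat_mult)
    qed (use \<epsilon> in simp)
    finally have 1: "\<epsilon> / real (q k) * (1 / (real (Suc j) * F + A)) \<le> \<psi> (Suc j * q k)"
      by (simp add: \<psi>_def)
    \<comment> \<open>Here \<open>\<epsilon> \<le> 1 / 4\<close> enters:
      \<open>q (Suc k) \<le> 2 * A * q k\<close> and \<open>err_lower\<close> cost a factor 2
      each.\<close>
    have "\<epsilon> / real (q k) * (1 / (real (Suc j) * F + A)) \<le> (1 / 4) / real (q k) * (1 / A)"
      using \<epsilon> Q A jF by (intro mult_mono divide_right_mono divide_left_mono) auto
    also have "\<dots> = 1 / (4 * A * real (q k))" by simp
    also have "\<dots> \<le> 1 / (2 * real (q (Suc k)))"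
    proof (rule divide_left_mono)
      have "(A + 1) * real (q k) \<le> 2 * A * real (q k)" using A Q by (intro mult_right_mono) auto
      then show "2 * real (q (Suc k)) \<le> 4 * A * real (q k)" using Q_Suc by linarith
      show "0 < 4 * A * real (q k) * (2 * real (q (Suc k)))"
        using A Q q_pos[of "Suc k"] by (intro mult_pos_pos) auto
    qed simp
    also have "\<dots> \<le> \<bar>err k\<bar>" using err_lower[of k] q_pos[of "Suc k"] by (simp add: divide_le_eq)
    finally show "\<epsilon> / real (q k) * (1 / (real (Suc j) * F + A)) \<le> min (\<psi> (Suc j * q k)) \<bar>err k\<bar>"
      using 1 by simp
  qed
  finally show ?thesis by (simp add: F_def field_simps)
qed

text \<open>A point off the orbit has positive distance \<open>d\<close> from the orbit points with
  index up to \<open>N\<close>. Once the radii are below \<open>d\<close>, membership in a stage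
  must come from a larger index.\<close>

lemma infinitely_often_of_stages:
  assumes antimono: "\<And>m n. 1 \<le> m \<Longrightarrow> m \<le> n \<Longrightarrow> \<psi> n \<le> \<psi> m" and lim: "\<psi> \<longlonglongrightarrow> 0"
    and not_orbit: "\<And>n. real n * \<theta> - s \<notin> \<int>"
    and stages: "\<And>K. k0 \<le> K \<Longrightarrow> \<exists>k\<ge>K. s \<in> near (stage \<psi> k)"
  shows "\<exists>n\<ge>N. dist_int (real n * \<theta> - s) < \<psi> n"
proof -
  define d where "d = Min ((\<lambda>n. dist_int (real n * \<theta> - s)) ` {..N})"
  have "0 < dist_int (real n * \<theta> - s)" for n
    using not_orbit[of n] dist_int_nonneg dist_int_eq_0_iff by (metis order_le_less)
  then have "0 < d" by (simp add: d_def)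
  then obtain M where M: "\<And>n. M \<le> n \<Longrightarrow> \<psi> n < d"
    using order_tendstoD(2)[OF lim] by (auto simp: eventually_sequentially)
  obtain k where k: "max M k0 \<le> k" "s \<in> near (stage \<psi> k)"
    using stages[of "max M k0"] by auto
  then obtain n where n: "1 \<le> n" and close: "dist_int (real n * \<theta> - s) < \<psi> (max n (q k))"
    by (auto simp: near_def stage_def)
  have "M \<le> max n (q k)" using k(1) q_ge[of k] by linarith
  from M[OF this] close have "dist_int (real n * \<theta> - s) < d" by simp
  moreover have "d \<le> dist_int (real n * \<theta> - s)" if "n \<le> N"
    unfolding d_def using that by (intro Min_le) auto
  ultimately have "N \<le> n" by force
  moreover have "\<psi> (max n (q k)) \<le> \<psi> n" using n by (intro antimono) auto
  ultimately show ?thesis using close by (meson less_le_trans)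
qed

text \<open>Applying \<open>null_complement_near_Union\<close> to the stages from each
  \<open>K \<ge> k0\<close> on shows that almost every point lies in infinitely many stages.\<close>

lemma infinitely_often_of_divergence:
  fixes \<phi> :: "nat \<Rightarrow> real" and \<epsilon> :: real
  assumes \<phi>: "\<And>n. 1 \<le> n \<Longrightarrow> 0 < \<phi> n" "mono_on {1..} \<phi>" and \<epsilon>: "0 < \<epsilon>" "\<epsilon> \<le> 1 / 4"
    and ge_1: "\<And>k. k0 \<le> k \<Longrightarrow> 1 \<le> \<phi> (q k)"
    and diverges: "\<not> summable (\<lambda>k. ln (min (\<phi> (q k)) (real (q (Suc k)) / real (q k))) / \<phi> (q k))"
  shows "AE s in lebesgue. \<forall>N. \<exists>n\<ge>N. dist_int (real n * \<theta> - s) < \<epsilon> / (real n * \<phi> n)"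
proof -
  define \<psi> where "\<psi> n = \<epsilon> / (real n * \<phi> n)" for n
  have \<phi>_mono: "\<phi> m \<le> \<phi> n" if "1 \<le> m" "m \<le> n" for m n
    using that by (intro mono_onD[OF \<phi>(2)]) auto
  have antimono: "\<psi> n \<le> \<psi> m" if "1 \<le> m" "m \<le> n" for m n
    unfolding \<psi>_def
  proof (rule divide_left_mono)
    show "real m * \<phi> m \<le> real n * \<phi> n"
      using that \<phi>_mono[OF that] \<phi>(1)[of m] by (intro mult_mono) auto
    show "0 < real n * \<phi> n * (real m * \<phi> m)"
      using that \<phi>(1)[of m] \<phi>(1)[of n] by (intro mult_pos_pos) auto
  qed (use \<epsilon> in simp)
  have nonneg: "0 \<le> \<psi> n" if "1 \<le> n" for n
    unfolding \<psi>_def using \<phi>(1)[OF that] \<epsilon> by simp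
  have lim: "\<psi> \<longlonglongrightarrow> 0"
  proof (rule tendsto_sandwich)
    show "\<forall>\<^sub>F n in sequentially. 0 \<le> \<psi> n"
      using nonneg by (auto simp: eventually_sequentially)
    show "\<forall>\<^sub>F n in sequentially. \<psi> n \<le> (\<epsilon> / \<phi> 1) / real n"
    proof (rule eventually_sequentiallyI[of 1])
      fix n :: nat assume "1 \<le> n"
      then have "\<epsilon> / (real n * \<phi> n) \<le> \<epsilon> / (real n * \<phi> 1)"
        using \<epsilon> \<phi>_mono[of 1 n] \<phi>(1)[of 1] \<phi>(1)[of n] by (intro divide_left_mono mult_left_mono mult_pos_pos) auto
      then show "\<psi> n \<le> (\<epsilon> / \<phi> 1) / real n" by (simp add: \<psi>_def field_simps)
    qed
    show "(\<lambda>n. (\<epsilon> / \<phi> 1) / real n) \<longlonglongrightarrow> 0" by (rule lim_const_over_n)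
  qed simp
  define h where "h k = ln (min (\<phi> (q k)) (real (q (Suc k)) / real (q k)))" for k
  have ratio: "1 \<le> real (q (Suc k)) / real (q k)" for k
    using q_mono_Suc[of k] q_pos[of k] by simp
  define N where "N K = {0..<1} - near (\<Union>k. stage \<psi> (k + K))" for K
  have "N K \<in> null_sets lborel" if K: "k0 \<le> K" for K
    unfolding N_def
  proof (rule null_complement_near_Union[where q = "\<lambda>k. q (k + K)"
        and t = "\<lambda>k. \<epsilon> / 2 * (h (k + K) / \<phi> (q (Suc (k + K))))"])
    have F: "1 \<le> \<phi> (q (k + K))" for k using ge_1 K by simp
    have h: "0 \<le> h (k + K)" for k unfolding h_def using F ratio by (intro ln_ge_zero) simp
    show "\<not> summable (\<lambda>k. \<epsilon> / 2 * (h (k + K) / \<phi> (q (Suc (k + K)))))"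
    proof -
      have "\<not> summable (\<lambda>k. h (k + K) / \<phi> (q (k + K)))"
        using diverges summable_iff_shift[of "\<lambda>k. h k / \<phi> (q k)" K] by (simp add: h_def)
      moreover have "h (k + K) \<le> ln (\<phi> (q (k + K)))" for k
        unfolding h_def using F[of k] ratio[of "k + K"] by (intro ln_mono) auto
      moreover have "\<phi> (q (k + K)) \<le> \<phi> (q (Suc k + K))" for k
        using q_pos[of "k + K"] q_mono_Suc[of "k + K"] by (intro \<phi>_mono) auto
      ultimately have "\<not> summable (\<lambda>k. h (k + K) / \<phi> (q (Suc k + K)))"
        using F h by (intro not_summable_shift_denominator[of "\<lambda>k. \<phi> (q (k + K))" "\<lambda>k. h (k + K)"]) auto
      then show ?thesis using \<epsilon> by (simp add: del: conv_denom.simps times_divide_eq_right)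
    qed
    show "0 \<le> \<epsilon> / 2 * (h (k + K) / \<phi> (q (Suc (k + K))))" for k
      using h[of k] F[of "Suc k"] \<epsilon> by simp
    show "\<epsilon> / 2 * (h (k + K) / \<phi> (q (Suc (k + K)))) / real (q (k + K))
        \<le> measure lborel (near (stage \<psi> (k + K)) \<inter> tile (q (k + K)) i)" for k i
    proof -
      let ?k = "k + K"
      have Fk: "1 \<le> \<phi> (q (Suc ?k))" using F[of "Suc k"] by simp
      \<comment> \<open>Inside the logarithm, replacing \<open>\<phi> (q k)\<close> by its value at
        the next index only helps; the series comparison is needed for the denominator
        alone.\<close>
      have "h ?k \<le> ln (min (\<phi> (q (Suc ?k))) (real (q (Suc ?k)) / real (q ?k)))"
        unfolding h_def using F[of k] ratio[of ?k] \<phi>_mono[OF q_pos q_mono_Suc, of ?k]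
        by (intro ln_mono) auto
      then have "\<epsilon> / 2 * (h ?k / \<phi> (q (Suc ?k))) / real (q ?k)
          \<le> \<epsilon> / 2 * (ln (min (\<phi> (q (Suc ?k))) (real (q (Suc ?k)) / real (q ?k))) / \<phi> (q (Suc ?k))) / real (q ?k)"
        using Fk \<epsilon> by (intro divide_right_mono mult_left_mono) auto
      also have "\<dots> \<le> (\<Sum>j<a (Suc ?k). min (\<psi> (Suc j * q ?k)) \<bar>err ?k\<bar>)"
        unfolding \<psi>_def using \<phi> \<epsilon> Fk by (rule stage_mass_lower_bound)
      also have "\<dots> \<le> measure lborel (near (stage \<psi> ?k) \<inter> tile (q ?k) i)"
        using antimono nonneg by (rule stage_mass_on_tile)
      finally show ?thesis .
    qed
    show "finite (stage \<psi> (k + K))" for k by (simp add: stage_def)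
    show "card (stage \<psi> (k + K)) \<le> q (Suc k + K)" for k
      unfolding stage_def using card_image_le[of "{1..q (Suc (k + K))}"] by simp
  qed (use q_pos q_mono_Suc q_double in auto)
  then have negl_N: "negligible (N K)" if "k0 \<le> K" for K
    using that by (simp add: negligible_iff_null_sets null_sets_completionI)
  \<comment> \<open>Integer translates carry the null sets of the unit interval to the whole line;
    \<open>R\<close> is the countable orbit modulo 1, excluded by \<open>not_orbit\<close>.\<close>
  define Z where "Z = (\<Union>z::int. (+) (of_int z) ` (\<Union>K\<in>{k0..}. N K))"
  define R where "R = (\<Union>z::int. \<Union>n::nat. {real n * \<theta> - of_int z})"
  have "negligible Z"
    unfolding Z_def using negl_N by (intro negligible_UN_countable negligible_translation) auto
  moreover have "negligible R"
    unfolding R_def by (intro negligible_UN_countable) auto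
  ultimately have "negligible (Z \<union> R)" by simp
  moreover have "\<exists>n\<ge>M. dist_int (real n * \<theta> - s) < \<psi> n" if s: "s \<notin> Z \<union> R" for s M
  proof (rule infinitely_often_of_stages[OF antimono lim])
    show "real n * \<theta> - s \<notin> \<int>" for n
    proof
      assume "real n * \<theta> - s \<in> \<int>"
      then obtain z where "real n * \<theta> - s = of_int z" by (auto elim: Ints_cases)
      then have "s = real n * \<theta> - of_int z" by linarith
      then have "s \<in> R" unfolding R_def by blast
      with s show False by blast
    qed
    fix K assume K: "k0 \<le> K"
    have "frac s \<notin> N K"
    proof
      assume "frac s \<in> N K"
      then have "of_int \<lfloor>s\<rfloor> + frac s \<in> Z" unfolding Z_def using K by blast
      then show False using s by (simp add: frac_def)
    qed
    then obtain k where "frac s \<in> near (stage \<psi> (k + K))"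
      unfolding N_def near_Union by (auto simp: frac_ge_0 frac_lt_1)
    moreover have "dist_int (x - frac s) = dist_int (x - s)" for x
      using dist_int_add_of_int[of "x - s" "\<lfloor>s\<rfloor>"] by (simp add: frac_def algebra_simps)
    ultimately show "\<exists>k\<ge>K. s \<in> near (stage \<psi> k)" by (auto simp: near_def intro!: exI[of _ "k + K"])
  qed
  then have "{s. \<not> (\<forall>M. \<exists>n\<ge>M. dist_int (real n * \<theta> - s) < \<psi> n)} \<subseteq> Z \<union> R" by blast
  ultimately show ?thesis
    unfolding \<psi>_def negligible_iff_null_sets by (intro AE_I'[of "Z \<union> R"]) simp_all
qed

end

section \<open>Convergence\<close>

context irrational_unit
begin

text \<open>Modulo 1, adding \<open>j * q k\<close> to the index moves the point by
  \<open>j * err k\<close>. This lets one arc absorb many arcs of a residue class.\<close>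

lemma multiple_near_shifted:
  "dist_int (real m * \<theta> - s) \<le> dist_int (real (m + j * q k) * \<theta> - s) + real j * \<bar>err k\<bar>"
proof -
  have "real (m + j * q k) * \<theta> - s = (real m * \<theta> - s + real j * err k) + of_int (int j * conv_num \<theta> k)"
    by (simp add: err_def algebra_simps)
  then have "dist_int (real (m + j * q k) * \<theta> - s) = dist_int (real m * \<theta> - s + real j * err k)"
    by (simp only: dist_int_add_of_int)
  then show ?thesis
    using dist_int_lipschitz[of "real m * \<theta> - s" "real m * \<theta> - s + real j * err k"]
    by (simp add: abs_mult)
qed

text \<open>Unlike the index ranges of \<open>stage\<close>, these ranges partition the positive
  integers, and the radii are not cut down: an upper bound needs every arc, once and in
  full.\<close>

definition block :: "(nat \<Rightarrow> real) \<Rightarrow> nat \<Rightarrow> (real \<times> real) set" where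
  "block \<psi> k = (\<lambda>n. (real n * \<theta>, \<psi> n)) ` {q k..<q (Suc k)}"

text \<open>Up to the index \<open>q (k + 1) / F\<close> the arcs around each class of multiples modulo \<open>q k\<close> overlap
  so much that one arc of radius \<open>2 / (F * q k)\<close> covers them; beyond it, the arcs are summed up
  individually.\<close>

lemma measure_block_le:
  fixes \<phi> :: "nat \<Rightarrow> real" and c :: real
  defines "\<psi> \<equiv> \<lambda>n. 1 / (real n * \<phi> n)"
  assumes \<phi>: "\<And>n. 1 \<le> n \<Longrightarrow> 0 < \<phi> n" "mono_on {1..} \<phi>" and c: "1 < c" "c \<le> \<phi> (q k)"
  shows "measure lborel (near (block \<psi> k) \<inter> {0..<1})
    \<le> (4 + 4 / ln c) * (ln (min (\<phi> (q k)) (real (q (Suc k)) / real (q k))) / \<phi> (q k))"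
proof -
  define F where "F = \<phi> (q k)"
  define A where "A = real (q (Suc k)) / real (q k)"
  have F: "1 < F" "c \<le> F" using c by (auto simp: F_def)
  have Q: "1 \<le> real (q k)" using q_pos[of k] by simp
  have A: "1 \<le> A" using q_mono_Suc[of k] Q by (simp add: A_def)
  have \<psi>_le: "\<psi> n \<le> 1 / (real n * F)" and \<psi>_nonneg: "0 \<le> \<psi> n" if "q k \<le> n" for n
  proof -
    have n: "1 \<le> n" using that q_pos[of k] by linarith
    have "F \<le> \<phi> n" unfolding F_def using that q_pos[of k] n by (intro mono_onD[OF \<phi>(2)]) auto
    then show "\<psi> n \<le> 1 / (real n * F)" unfolding \<psi>_def
      using F n by (intro divide_left_mono mult_left_mono mult_pos_pos) auto
    show "0 \<le> \<psi> n" unfolding \<psi>_def using \<phi>(1)[OF n] by simp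
  qed
  have sum_le: "2 * (\<Sum>(x, r)\<in>(\<lambda>n. (real n * \<theta>, \<psi> n)) ` {m..<q (Suc k)}. r)
      \<le> 4 / F * ln (real (q (Suc k)) / real m)" if m: "q k \<le> m" "m \<le> q (Suc k)" for m
  proof -
    have "(\<Sum>(x, r)\<in>(\<lambda>n. (real n * \<theta>, \<psi> n)) ` {m..<q (Suc k)}. r) \<le> (\<Sum>n\<in>{m..<q (Suc k)}. \<psi> n)"
      using m \<psi>_nonneg by (intro sum_image_snd_le) auto
    also have "\<dots> \<le> (\<Sum>n\<in>{m..<q (Suc k)}. 1 / F * (1 / real n))"
      using m \<psi>_le by (intro sum_mono) (auto simp: mult.commute)
    also have "\<dots> = 1 / F * (\<Sum>n\<in>{m..<q (Suc k)}. 1 / real n)" by (rule sum_distrib_left[symmetric])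
    also have "\<dots> \<le> 1 / F * (2 * ln (real (q (Suc k)) / real m))"
      using F m q_pos[of k] by (intro mult_left_mono sum_inverse_le_ln) auto
    finally show ?thesis by simp
  qed
  have ln_c: "0 < ln c" using c by simp
  show ?thesis
  proof (cases "A \<le> F")
    case True
    \<comment> \<open>The block is short relative to \<open>F\<close>, so summing all arc lengths
      separately already gives \<open>ln A / F\<close>.\<close>
    have "measure lborel (near (block \<psi> k) \<inter> {0..<1}) \<le> 2 * (\<Sum>(x, r)\<in>block \<psi> k. r)"
      using \<psi>_nonneg by (intro measure_near_le) (auto simp: block_def)
    also have "\<dots> \<le> 4 / F * ln A"
      unfolding block_def A_def using q_mono_Suc by (intro sum_le) auto
    also have "\<dots> = 4 * (ln A / F)" by simp
    also have "\<dots> \<le> (4 + 4 / ln c) * (ln A / F)"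
      using F A ln_c by (intro mult_right_mono) auto
    finally show ?thesis using True by (simp add: F_def[symmetric] A_def[symmetric] min_absorb2)
  next
    case False
    define M where "M = nat \<lceil>real (q (Suc k)) / F\<rceil>"
    have "real (q k) < real (q (Suc k)) / F" using False F Q by (simp add: A_def field_simps)
    moreover have M_ge: "real (q (Suc k)) / F \<le> real M" unfolding M_def by linarith
    ultimately have qM: "q k \<le> M" by linarith
    have "real (q (Suc k)) / F \<le> real (q (Suc k))" using F mult_left_mono[of 1 F "real (q (Suc k))"] by (simp add: pos_divide_le_eq)
    then have Mq: "M \<le> q (Suc k)" unfolding M_def by linarith
    \<comment> \<open>Half of the radius covers the drift \<open>j * \<bar>err k\<bar>\<close> along
      the residue class, the other half the radius \<open>\<psi> n\<close> itself.\<close>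
    define P where "P = (\<lambda>m. (real m * \<theta>, 2 / (F * real (q k)))) ` {..<q k}"
    define P' where "P' = (\<lambda>n. (real n * \<theta>, \<psi> n)) ` {M..<q (Suc k)}"
    have "near (block \<psi> k) \<subseteq> near (P \<union> P')"
    proof
      fix s assume "s \<in> near (block \<psi> k)"
      then obtain n where n: "q k \<le> n" "n < q (Suc k)" and close: "dist_int (real n * \<theta> - s) < \<psi> n"
        by (auto simp: near_def block_def)
      show "s \<in> near (P \<union> P')"
      proof (cases "M \<le> n")
        case True
        then have "s \<in> near P'" unfolding near_def P'_def using n close by force
        then show ?thesis by (simp add: near_Un)
      next
        case less: False
        define m j where "m = n mod q k" and "j = n div q k"
        have nmj: "n = m + j * q k" and m: "m < q k" using q_pos[of k] by (simp_all add: m_def j_def mod_div_mult_eq)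
        have "real n < real (q (Suc k)) / F" using less unfolding M_def by linarith
        moreover have "real j * real (q k) \<le> real n"
          unfolding nmj by simp
        ultimately have "real j * real (q k) * F \<le> real (q (Suc k))"
          using F by (simp add: pos_less_divide_eq) (meson less_imp_le mult_right_mono order_trans less_trans zero_less_one)
        then have "real j * real (q k) * F * \<bar>err k\<bar> \<le> real (q (Suc k)) * \<bar>err k\<bar>"
          by (intro mult_right_mono) auto
        also have "\<dots> \<le> 1" using err_upper[of k] by (simp add: mult.commute)
        finally have "real j * \<bar>err k\<bar> \<le> 1 / (F * real (q k))"
          using F Q by (simp add: field_simps)
        moreover have "\<psi> n \<le> 1 / (F * real (q k))"
        proof -
          have "1 / (real n * F) \<le> 1 / (F * real (q k))"
            using n Q F by (intro divide_left_mono) (auto simp: mult.commute)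
          then show ?thesis using \<psi>_le[OF n(1)] by linarith
        qed
        ultimately have "dist_int (real m * \<theta> - s) < 2 / (F * real (q k))"
          using multiple_near_shifted[of m s j k] close unfolding nmj[symmetric] by simp
        then show ?thesis using m by (auto simp: near_def P_def)
      qed
    qed
    then have "measure lborel (near (block \<psi> k) \<inter> {0..<1})
        \<le> measure lborel ((near P \<inter> {0..<1}) \<union> (near P' \<inter> {0..<1}))"
      unfolding near_Un
      by (intro measure_mono_fmeasurable fmeasurable.Un)
        (auto simp: Int_commute[of "near _"] fmeasurable_Int_fmeasurable fmeasurable_Ico)
    also have "\<dots> \<le> measure lborel (near P \<inter> {0..<1}) + measure lborel (near P' \<inter> {0..<1})"
      by (intro measure_Un_le) auto
    also have "measure lborel (near P \<inter> {0..<1}) \<le> 4 / F * (ln F / ln c)"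
    proof -
      have "measure lborel (near P \<inter> {0..<1}) \<le> 2 * (\<Sum>(x, r)\<in>P. r)"
        using F Q by (intro measure_near_le) (auto simp: P_def)
      also have "(\<Sum>(x, r)\<in>P. r) \<le> (\<Sum>m<q k. 2 / (F * real (q k)))"
        unfolding P_def using F Q by (intro sum_image_snd_le) auto
      finally have "measure lborel (near P \<inter> {0..<1}) \<le> 4 / F * 1" using F Q by simp
      \<comment> \<open>The merged arcs have total length of order \<open>1 / F\<close>; the lower
        bound \<open>c > 1\<close> turns this into a multiple of \<open>ln F / F\<close>.\<close>
      also have "ln c \<le> ln F" using c F by (intro ln_mono) auto
      then have "4 / F * 1 \<le> 4 / F * (ln F / ln c)" using F ln_c by (intro mult_left_mono) auto
      finally show ?thesis .
    qed
    also have "measure lborel (near P' \<inter> {0..<1}) \<le> 4 / F * ln F"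
    proof -
      have "measure lborel (near P' \<inter> {0..<1}) \<le> 2 * (\<Sum>(x, r)\<in>P'. r)"
        using \<psi>_nonneg qM by (intro measure_near_le) (auto simp: P'_def)
      also have "\<dots> \<le> 4 / F * ln (real (q (Suc k)) / real M)"
        unfolding P'_def using qM Mq by (intro sum_le)
      also have "\<dots> \<le> 4 / F * ln F"
      proof (intro mult_left_mono ln_mono)
        show "real (q (Suc k)) / real M \<le> F" 
          using M_ge F qM Q by (simp add: field_simps)
      qed (use F qM Q q_pos[of "Suc k"] in auto)
      finally show ?thesis .
    qed
    finally have "measure lborel (near (block \<psi> k) \<inter> {0..<1}) \<le> (4 + 4 / ln c) * (ln F / F)"
      by (simp add: algebra_simps)
    then show ?thesis using False by (simp add: F_def[symmetric] A_def[symmetric] min_absorb1)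
  qed
qed

text \<open>The block measures are summable, so Borel--Cantelli leaves almost every point in
  finitely many blocks. The unit interval suffices, since one set of positive measure refutes an
  almost everywhere claim.\<close>

lemma finitely_often_of_convergence:
  fixes \<phi> :: "nat \<Rightarrow> real" and c :: real
  assumes \<phi>: "\<And>n. 1 \<le> n \<Longrightarrow> 0 < \<phi> n" "mono_on {1..} \<phi>"
    and c: "1 < c" "\<And>k. k0 \<le> k \<Longrightarrow> c \<le> \<phi> (q k)"
    and converges: "summable (\<lambda>k. ln (min (\<phi> (q k)) (real (q (Suc k)) / real (q k))) / \<phi> (q k))"
  shows "AE s in lborel. s \<in> {0..<1} \<longrightarrow>
    (\<forall>\<^sub>F n in sequentially. 1 / (real n * \<phi> n) \<le> dist_int (real n * \<theta> - s))"
proof -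
  define \<psi> where "\<psi> n = 1 / (real n * \<phi> n)" for n
  define h where "h k = ln (min (\<phi> (q k)) (real (q (Suc k)) / real (q k))) / \<phi> (q k)" for k
  define E where "E k = near (block \<psi> (k + k0)) \<inter> {0..<1}" for k
  have fm: "E k \<in> fmeasurable lborel" for k
    unfolding E_def by (simp add: Int_commute[of "near _"] fmeasurable_Int_fmeasurable fmeasurable_Ico)
  have "summable (\<lambda>k. measure lborel (E k))"
  proof (rule summable_comparison_test')
    show "summable (\<lambda>k. (4 + 4 / ln c) * h (k + k0))"
    proof (rule summable_mult)
      show "summable (\<lambda>k. h (k + k0))"
        unfolding summable_iff_shift using converges by (simp only: h_def[abs_def])
    qed
    show "norm (measure lborel (E k)) \<le> (4 + 4 / ln c) * h (k + k0)" for k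
      using measure_block_le[OF \<phi> c(1) c(2)[of "k + k0"]] by (simp add: E_def h_def \<psi>_def[abs_def])
  qed
  then have "AE s in lborel. eventually (\<lambda>k. s \<in> space lborel - E k) sequentially"
    using fm by (intro borel_cantelli_AE1) (auto simp: fmeasurable_def)
  then show ?thesis
  proof (rule AE_mp, intro AE_I2 impI)
    fix s :: real assume "\<forall>\<^sub>F k in sequentially. s \<in> space lborel - E k" and s: "s \<in> {0..<1}"
    then obtain K where K: "\<And>k. K \<le> k \<Longrightarrow> s \<notin> E k" by (auto simp: eventually_sequentially)
    show "\<forall>\<^sub>F n in sequentially. 1 / (real n * \<phi> n) \<le> dist_int (real n * \<theta> - s)"
    proof (rule eventually_sequentiallyI[of "q (K + k0)"])
      fix n assume n: "q (K + k0) \<le> n"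
      then have "1 \<le> n" using q_pos[of "K + k0"] by linarith
      then obtain k where k: "q k \<le> n" "n < q (Suc k)" by (rule obtain_block)
      have "K + k0 \<le> k"
      proof (rule ccontr)
        assume "\<not> K + k0 \<le> k"
        then have "q (Suc k) \<le> q (K + k0)" by (intro q_mono) simp
        then show False using n k by linarith
      qed
      then have "s \<notin> E (k - k0)" "k - k0 + k0 = k" using K[of "k - k0"] by auto
      then have "s \<notin> near (block \<psi> k)" using s by (simp add: E_def)
      then show "1 / (real n * \<phi> n) \<le> dist_int (real n * \<theta> - s)"
        using k by (force simp: near_def block_def \<psi>_def)
    qed
  qed
qed

end

section \<open>The equivalence from the convergence and divergence parts\<close>

theorem theorem1:
  fixes \<theta> :: real and \<phi> :: "nat \<Rightarrow> real"
  assumes "0 < \<theta>" and "\<theta> < 1" and "\<theta> \<notin> \<rat>"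
    and pos: "\<And>n. n \<ge> 1 \<Longrightarrow> 0 < \<phi> n"
    and mono: "mono_on {1..} \<phi>"
    and nondegenerate: "\<exists>n\<ge>1. 1 < \<phi> n"
  shows "(AE s in lebesgue.
            liminf (\<lambda>n. ereal (real n * \<phi> n * dist_int (real n * \<theta> - s))) = 0)
     \<longleftrightarrow> filterlim
            (\<lambda>K. \<Sum>k<K. ln (min (\<phi> (conv_denom \<theta> k))
                                (real (conv_denom \<theta> (Suc k)) / real (conv_denom \<theta> k)))
                          / \<phi> (conv_denom \<theta> k))
            at_top sequentially"
proof -
  interpret irrational_unit \<theta> using assms by unfold_locales
  define h where "h k = ln (min (\<phi> (q k)) (real (q (Suc k)) / real (q k))) / \<phi> (q k)" for k
  define f where "f s n = real n * \<phi> n * dist_int (real n * \<theta> - s)" for s n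
  have f_nonneg: "0 \<le> f s n" for s n
    unfolding f_def using pos[of n] dist_int_nonneg by (cases n) auto
  \<comment> \<open>If \<open>\<phi>\<close> never exceeded 1, all terms of the series would be
    nonpositive, while the liminf would still vanish almost everywhere, by comparison with the
    constant function 2. \<open>nondegenerate\<close> excludes this, and \<open>\<phi> n0\<close>
    serves as the constant above 1 in the convergence part.\<close>
  obtain n0 where n0: "1 \<le> n0" "1 < \<phi> n0" using nondegenerate by blast
  have large: "\<phi> n0 \<le> \<phi> (q k)" if "n0 \<le> k" for k
    using that n0 q_ge[of k] by (intro mono_onD[OF mono]) auto
  have h_nonneg: "0 \<le> h k" if "n0 \<le> k" for k
  proof -
    have "1 \<le> real (q (Suc k)) / real (q k)" using q_mono_Suc[of k] q_pos[of k] by simp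
    then show ?thesis unfolding h_def using large[OF that] n0
      by (intro divide_nonneg_nonneg ln_ge_zero) auto
  qed
  have "(AE s in lebesgue. liminf (\<lambda>n. ereal (f s n)) = 0) \<longleftrightarrow> \<not> summable h"
  proof
    assume zero: "AE s in lebesgue. liminf (\<lambda>n. ereal (f s n)) = 0"
    show "\<not> summable h"
    proof
      \<comment> \<open>Convergence forces liminf at least 1 almost everywhere on the unit interval,
        which would then be a null set.\<close>
      assume "summable h"
      have "AE s in lborel. s \<in> {0..<1} \<longrightarrow>
          (\<forall>\<^sub>F n in sequentially. 1 / (real n * \<phi> n) \<le> dist_int (real n * \<theta> - s))"
        using pos mono n0(2) large \<open>summable h\<close>[unfolded h_def] by (rule finitely_often_of_convergence)
      then have "AE s in lebesgue. s \<in> {0..<1} \<longrightarrow>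
          (\<forall>\<^sub>F n in sequentially. 1 / (real n * \<phi> n) \<le> dist_int (real n * \<theta> - s))"
        by (rule AE_completion)
      with zero have "AE s in lebesgue. s \<notin> {0..<1::real}"
      proof eventually_elim
        case (elim s)
        show ?case
        proof
          assume "s \<in> {0..<1}"
          with elim have "\<forall>\<^sub>F n in sequentially. 1 / (real n * \<phi> n) \<le> dist_int (real n * \<theta> - s)"
            by blast
          then have "\<forall>\<^sub>F n in sequentially. (1::ereal) \<le> ereal (f s n)"
            using eventually_ge_at_top[of 1]
          proof eventually_elim
            case (elim n)
            then have "0 < real n * \<phi> n" using pos[of n] by simp
            with elim show ?case by (simp add: f_def divide_le_eq mult.commute)
          qed
          then have "1 \<le> liminf (\<lambda>n. ereal (f s n))" by (rule Liminf_bounded)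
          with elim show False by simp
        qed
      qed
      moreover have "{0..<1::real} \<in> sets lebesgue" by simp
      ultimately have "{0..<1::real} \<in> null_sets lebesgue"
        using AE_iff_null_sets[of "{0..<1::real}" lebesgue] by blast
      then show False by (simp add: null_sets_def)
    qed
  next
    assume div: "\<not> summable h"
    \<comment> \<open>The values \<open>1 / (m + 4)\<close> respect the bound \<open>1 / 4\<close>
      and tend to 0; as they are countably many, the exceptional null sets can be combined.\<close>
    have "AE s in lebesgue. \<forall>N. \<exists>n\<ge>N. dist_int (real n * \<theta> - s) < 1 / (real m + 4) / (real n * \<phi> n)" for m
    proof (rule infinitely_often_of_divergence[OF pos mono])
      show "1 \<le> \<phi> (q k)" if "n0 \<le> k" for k using large[OF that] n0 by simp
    qed (use div in \<open>simp_all add: h_def[abs_def]\<close>)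
    then have "AE s in lebesgue. \<forall>m::nat. \<forall>N. \<exists>n\<ge>N.
        dist_int (real n * \<theta> - s) < 1 / (real m + 4) / (real n * \<phi> n)"
      by (simp add: AE_all_countable)
    then show "AE s in lebesgue. liminf (\<lambda>n. ereal (f s n)) = 0"
    proof eventually_elim
      case (elim s)
      have "liminf (\<lambda>n. ereal (f s n)) \<le> 0"
      proof (rule ccontr)
        assume "\<not> liminf (\<lambda>n. ereal (f s n)) \<le> 0"
        then obtain e where e: "0 < ereal e" "ereal e < liminf (\<lambda>n. ereal (f s n))"
          using ereal_dense2 by (metis not_le)
        then obtain N where N: "\<And>n. N \<le> n \<Longrightarrow> e < f s n"
          using less_LiminfD[OF e(2)] by (auto simp: eventually_sequentially)
        obtain m :: nat where m: "1 / e < real m" using reals_Archimedean2 by blast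
        obtain n where n: "max N 1 \<le> n"
          and close: "dist_int (real n * \<theta> - s) < 1 / (real m + 4) / (real n * \<phi> n)"
          using elim by blast
        have "0 < real n * \<phi> n" using pos[of n] n by simp
        then have "dist_int (real n * \<theta> - s) * (real n * \<phi> n) < 1 / (real m + 4)"
          using close by (simp only: pos_less_divide_eq)
        then have "f s n < 1 / (real m + 4)" by (simp only: f_def mult.commute)
        also have "\<dots> < e" using m e(1) by (simp add: field_simps)
        finally show False using N[of n] n by simp
      qed
      moreover have "0 \<le> liminf (\<lambda>n. ereal (f s n))"
        using f_nonneg by (intro Liminf_bounded always_eventually) simp
      ultimately show ?case by (rule antisym)
    qed
  qed
  also have "\<dots> \<longleftrightarrow> filterlim (\<lambda>K. \<Sum>k<K. h k) at_top sequentially"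
    by (rule filterlim_sum_at_top_iff_not_summable[symmetric, OF h_nonneg])
  finally show ?thesis unfolding f_def h_def .
qed

end
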